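(* Let $D\ne0$ be a nonzero locally finite $\Bbbk$-derivation of the first Weyl algebra $A_1$. Then the following conditions are equivalent: (i) $D$ is locally nilpotent; (ii) $\mathrm{Aut}_D(A_1)$ contains automorphisms of arbitrarily large degree, i.e. for every integer $d\ge1$ there is $\rho\in\mathrm{Aut}_D(A_1)$ with $\deg(\rho)\ge d$.
   Context: $\Bbbk$ is an algebraically closed field of characteristic zero. $A_1=\Bbbk\langle p,q\mid pq-qp=1\rangle$ is the first Weyl algebra; every $u\in A_1$ is written uniquely as a finite sum $u=\sum_{i,j\ge0}c_{ij}p^iq^j$ with $c_{ij}\in\Bbbk$, and $\deg(u)=\max\{i+j\mid c_{ij}\ne0\}$. For a $\Bbbk$-algebra automorphism $\rho$ of $A_1$, $\deg(\rho)=\max\{\deg(\rho(p)),\deg(\rho(q))\}$. For a $\Bbbk$-derivation $D$ of a $\Bbbk$-algebra $A$: $\mathrm{Aut}_D(A)=\{\rho\in\mathrm{Aut}(A)\mid\rho D=D\rho\}$, where $\mathrm{Aut}(A)$ is the group of $\Bbbk$-algebra automorphisms; $D$ is locally finite if for every $a\in A$ the $\Bbbk$-span of $\{D^n(a)\mid n\ge0\}$ is finite-dimensional; $D$ is locally nilpotent if for every $a\in A$ there is $n\ge1$ with $D^n(a)=0$. *)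

theory Defs
  imports
    "HOL-Library.Poly_Mapping"
    "HOL-Computational_Algebra.Polynomial"
begin

text \<open>An algebra over the field \<open>'k\<close> is given by a ring \<open>'a\<close> and a scalar multiplication.\<close>

definition derivation :: "('k::field \<Rightarrow> 'a::ring_1 \<Rightarrow> 'a) \<Rightarrow> ('a \<Rightarrow> 'a) \<Rightarrow> bool" where
  "derivation scale D \<longleftrightarrow>
     Vector_Spaces.linear scale scale D \<and> (\<forall>a b. D (a * b) = D a * b + a * D b)"

definition algebra_aut :: "('k::field \<Rightarrow> 'a::ring_1 \<Rightarrow> 'a) \<Rightarrow> ('a \<Rightarrow> 'a) set" where
  "algebra_aut scale =
     {\<rho>. bij \<rho> \<and> Vector_Spaces.linear scale scale \<rho> \<and>
         \<rho> 1 = 1 \<and> (\<forall>a b. \<rho> (a * b) = \<rho> a * \<rho> b)}"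

definition aut_commuting ::
    "('k::field \<Rightarrow> 'a::ring_1 \<Rightarrow> 'a) \<Rightarrow> ('a \<Rightarrow> 'a) \<Rightarrow> ('a \<Rightarrow> 'a) set" where
  "aut_commuting scale D = {\<rho> \<in> algebra_aut scale. \<rho> \<circ> D = D \<circ> \<rho>}"

definition locally_finite :: "('k::field \<Rightarrow> 'a::ring_1 \<Rightarrow> 'a) \<Rightarrow> ('a \<Rightarrow> 'a) \<Rightarrow> bool" where
  "locally_finite scale D \<longleftrightarrow>
     (\<forall>a. \<exists>B. finite B \<and> module.span scale B = module.span scale (range (\<lambda>n. (D ^^ n) a)))"

definition locally_nilpotent :: "('a::ring_1 \<Rightarrow> 'a) \<Rightarrow> bool" where
  "locally_nilpotent D \<longleftrightarrow> (\<forall>a. \<exists>n\<ge>1. (D ^^ n) a = 0)"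

definition two_sided_ideal :: "'a::ring_1 set \<Rightarrow> bool" where
  "two_sided_ideal I \<longleftrightarrow>
     0 \<in> I \<and> (\<forall>x\<in>I. \<forall>y\<in>I. x + y \<in> I) \<and> (\<forall>r. \<forall>x\<in>I. r * x \<in> I \<and> x * r \<in> I)"

definition ideal_generated :: "'a::ring_1 set \<Rightarrow> 'a set" where
  "ideal_generated S = \<Inter>{I. two_sided_ideal I \<and> S \<subseteq> I}"

lemma two_sided_ideal_generated: "two_sided_ideal (ideal_generated S)"
  unfolding two_sided_ideal_def ideal_generated_def by blast

lemma ideal_generated_superset: "S \<subseteq> ideal_generated S"
  unfolding ideal_generated_def by blast

lemma ideal_generated_minimal: "two_sided_ideal I \<Longrightarrow> S \<subseteq> I \<Longrightarrow> ideal_generated S \<subseteq> I"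
  unfolding ideal_generated_def by blast

lemma two_sided_ideal_uminus: "two_sided_ideal I \<Longrightarrow> x \<in> I \<Longrightarrow> - x \<in> I"
  unfolding two_sided_ideal_def by (metis mult_minus1)

lemma two_sided_ideal_diff: "two_sided_ideal I \<Longrightarrow> x \<in> I \<Longrightarrow> y \<in> I \<Longrightarrow> x - y \<in> I"
  using two_sided_ideal_uminus[of I y] unfolding two_sided_ideal_def
  by (metis diff_conv_add_uminus)

datatype gen = P | Q

text \<open>
  Words form a monoid under concatenation, written additively: the multiplication of
  \<open>\<Rightarrow>\<^sub>0\<close> is the convolution with respect to the additive structure on the exponents.
\<close>

datatype word = Word (letters: "gen list")

instantiation word :: monoid_add
begin

definition zero_word :: word where "0 = Word []"

definition plus_word :: "word \<Rightarrow> word \<Rightarrow> word" where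
  "v + w = Word (letters v @ letters w)"

instance
  by standard (simp_all add: zero_word_def plus_word_def)

end

type_synonym 'k free_alg = "word \<Rightarrow>\<^sub>0 'k"

definition free_gen :: "gen \<Rightarrow> 'k::field free_alg" where
  "free_gen g = Poly_Mapping.single (Word [g]) 1"

definition free_const :: "'k::field \<Rightarrow> 'k free_alg" where
  "free_const c = Poly_Mapping.single 0 c"

lemma free_const_add: "free_const (c + d) = free_const c + free_const d"
  by (simp add: free_const_def single_add)

lemma free_const_mult: "free_const (c * d) = free_const c * free_const d"
  by (simp add: free_const_def mult_single)

lemma free_const_1: "free_const 1 = 1"
  by (simp add: free_const_def)

lemma free_alg_induct [case_names zero single add]:
  fixes f :: "'a \<Rightarrow>\<^sub>0 'k::field"
  assumes z: "R 0" and s: "\<And>w c. R (Poly_Mapping.single w c)" and a: "\<And>f g. R f \<Longrightarrow> R g \<Longrightarrow> R (f + g)"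
  shows "R f"
proof (induction f rule: update_induct)
  case const
  then show ?case by (rule z)
next
  case (update f k b)
  have "Poly_Mapping.update k b f = f + Poly_Mapping.single k b"
    using update(1) by (intro poly_mapping_eqI)
      (auto simp: lookup_update lookup_add lookup_single when_def in_keys_iff)
  then show ?case using a s update by metis
qed

lemma free_const_central: "free_const c * f = f * free_const c"
proof (induction f rule: free_alg_induct)
  case (single w d)
  then show ?case by (simp add: free_const_def mult_single mult.commute[of c d])
next
  case (add f g)
  then show ?case by (simp only: distrib_left distrib_right)
qed simp

definition weyl_ideal :: "'k::field free_alg set" where
  "weyl_ideal = ideal_generated {free_gen P * free_gen Q - free_gen Q * free_gen P - 1}"

lemma weyl_ideal_closed:
  "(0 :: 'k::field free_alg) \<in> weyl_ideal"
  "x \<in> weyl_ideal \<Longrightarrow> y \<in> weyl_ideal \<Longrightarrow> x + y \<in> weyl_ideal"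
  "x \<in> weyl_ideal \<Longrightarrow> y \<in> weyl_ideal \<Longrightarrow> x - y \<in> weyl_ideal"
  "x \<in> weyl_ideal \<Longrightarrow> - x \<in> weyl_ideal"
  "x \<in> weyl_ideal \<Longrightarrow> r * x \<in> weyl_ideal"
  "x \<in> weyl_ideal \<Longrightarrow> x * r \<in> weyl_ideal"
  for x y r :: "'k::field free_alg"
proof -
  have I: "two_sided_ideal (weyl_ideal :: 'k free_alg set)"
    unfolding weyl_ideal_def by (rule two_sided_ideal_generated)
  then show "(0 :: 'k free_alg) \<in> weyl_ideal"
    "x \<in> weyl_ideal \<Longrightarrow> y \<in> weyl_ideal \<Longrightarrow> x + y \<in> weyl_ideal"
    "x \<in> weyl_ideal \<Longrightarrow> r * x \<in> weyl_ideal"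
    "x \<in> weyl_ideal \<Longrightarrow> x * r \<in> weyl_ideal"
    by (simp_all add: two_sided_ideal_def)
  show "x \<in> weyl_ideal \<Longrightarrow> y \<in> weyl_ideal \<Longrightarrow> x - y \<in> weyl_ideal"
    "x \<in> weyl_ideal \<Longrightarrow> - x \<in> weyl_ideal"
    using two_sided_ideal_diff[OF I] two_sided_ideal_uminus[OF I] by simp_all
qed

definition weyl_cong :: "'k::field free_alg \<Rightarrow> 'k free_alg \<Rightarrow> bool" where
  "weyl_cong x y \<longleftrightarrow> x - y \<in> weyl_ideal"

lemma weyl_cong_equivp: "equivp (weyl_cong :: 'k::field free_alg \<Rightarrow> _)"
proof (rule equivpI)
  show "reflp (weyl_cong :: 'k free_alg \<Rightarrow> _)"
    by (simp add: reflp_def weyl_cong_def weyl_ideal_closed)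
  show "symp (weyl_cong :: 'k free_alg \<Rightarrow> _)"
    unfolding symp_def weyl_cong_def using weyl_ideal_closed(4) by fastforce
  show "transp (weyl_cong :: 'k free_alg \<Rightarrow> _)"
    unfolding transp_def weyl_cong_def
  proof (intro allI impI)
    fix x y z :: "'k free_alg"
    assume "x - y \<in> weyl_ideal" "y - z \<in> weyl_ideal"
    from weyl_ideal_closed(2)[OF this] show "x - z \<in> weyl_ideal" by simp
  qed
qed

lemma weyl_cong_refl: "weyl_cong x x"
  by (simp add: weyl_cong_def weyl_ideal_closed(1))

lemma weyl_cong_eqI: "x = y \<Longrightarrow> weyl_cong x y"
  by (simp add: weyl_cong_def weyl_ideal_closed(1))

lemma weyl_cong_mult:
  assumes "weyl_cong x x'" "weyl_cong y y'"
  shows "weyl_cong (x * y) (x' * y')"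
proof -
  have "x * y - x' * y' = (x - x') * y + x' * (y - y')"
    by (simp add: algebra_simps)
  then show ?thesis
    using assms by (simp add: weyl_cong_def weyl_ideal_closed)
qed

quotient_type (overloaded) 'k weyl = "'k::field free_alg" / weyl_cong
  by (rule weyl_cong_equivp)

instantiation weyl :: (field) ring
begin

lift_definition zero_weyl :: "'a weyl" is 0 .

lift_definition plus_weyl :: "'a weyl \<Rightarrow> 'a weyl \<Rightarrow> 'a weyl" is "(+)"
  unfolding weyl_cong_def by (drule (1) weyl_ideal_closed(2)) (simp add: algebra_simps)

lift_definition uminus_weyl :: "'a weyl \<Rightarrow> 'a weyl" is uminus
  unfolding weyl_cong_def by (drule weyl_ideal_closed(4)) simp

lift_definition minus_weyl :: "'a weyl \<Rightarrow> 'a weyl \<Rightarrow> 'a weyl" is "(-)"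
  unfolding weyl_cong_def by (drule (1) weyl_ideal_closed(3)) (simp add: algebra_simps)

lift_definition times_weyl :: "'a weyl \<Rightarrow> 'a weyl \<Rightarrow> 'a weyl" is "(*)"
  by (rule weyl_cong_mult)

instance
  by (standard; transfer; rule weyl_cong_eqI; simp add: algebra_simps)

end

text \<open>Action of the free algebra on polynomials: \<open>P\<close> is multiplication by the variable,
  \<open>Q\<close> is minus the derivative.\<close>

definition gen_act :: "gen \<Rightarrow> 'k::field poly \<Rightarrow> 'k poly" where
  "gen_act g = (case g of P \<Rightarrow> pCons 0 | Q \<Rightarrow> (\<lambda>f. - pderiv f))"

definition word_act :: "word \<Rightarrow> 'k::field poly \<Rightarrow> 'k poly" where
  "word_act w = foldr gen_act (letters w)"

definition free_act :: "'k::field free_alg \<Rightarrow> 'k poly \<Rightarrow> 'k poly" where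
  "free_act f g = (\<Sum>w\<in>Poly_Mapping.keys f. smult (Poly_Mapping.lookup f w) (word_act w g))"

lemma gen_act_add: "gen_act x (f + g) = gen_act x f + gen_act x g"
  by (cases x) (simp_all add: gen_act_def pderiv_add)

lemma gen_act_smult: "gen_act x (smult c f) = smult c (gen_act x f)"
  by (cases x) (simp_all add: gen_act_def pderiv_smult)

lemma word_act_add: "word_act w (f + g) = word_act w f + word_act w g"
proof -
  have "foldr gen_act xs (f + g) = foldr gen_act xs f + foldr gen_act xs g" for xs
    by (induction xs) (simp_all add: gen_act_add)
  then show ?thesis by (simp add: word_act_def)
qed

lemma word_act_smult: "word_act w (smult c f) = smult c (word_act w f)"
proof -
  have "foldr gen_act xs (smult c f) = smult c (foldr gen_act xs f)" for xs
    by (induction xs) (simp_all add: gen_act_smult)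
  then show ?thesis by (simp add: word_act_def)
qed

lemma word_act_0: "word_act 0 g = g"
  by (simp add: word_act_def zero_word_def)

lemma word_act_plus: "word_act (v + w) g = word_act v (word_act w g)"
  by (simp add: word_act_def plus_word_def)

lemma free_act_superset:
  assumes "finite A" "Poly_Mapping.keys f \<subseteq> A"
  shows "free_act f g = (\<Sum>w\<in>A. smult (Poly_Mapping.lookup f w) (word_act w g))"
  unfolding free_act_def using assms by (intro sum.mono_neutral_left) (auto simp: in_keys_iff)

lemma free_act_0: "free_act 0 g = 0"
  by (simp add: free_act_def)

lemma free_act_single: "free_act (Poly_Mapping.single w c) g = smult c (word_act w g)"
  by (subst free_act_superset[of "{w}"]) auto

lemma free_act_plus: "free_act (f + f') g = free_act f g + free_act f' g"
proof -
  let ?A = "Poly_Mapping.keys f \<union> Poly_Mapping.keys f'"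
  have "Poly_Mapping.keys (f + f') \<subseteq> ?A" by (rule Poly_Mapping.keys_add)
  then show ?thesis
    by (simp add: free_act_superset[of ?A] lookup_add smult_add_left sum.distrib)
qed

lemma free_act_add: "free_act f (g + h) = free_act f g + free_act f h"
  by (simp add: free_act_def word_act_add smult_add_right sum.distrib)

lemma free_act_smult: "free_act f (smult c g) = smult c (free_act f g)"
proof (induction f rule: free_alg_induct)
  case (single w d)
  then show ?case by (simp add: free_act_single word_act_smult mult.commute)
qed (simp_all add: free_act_0 free_act_plus smult_add_right)

lemma free_act_zero: "free_act f 0 = 0"
  using free_act_smult[of f 0 0] by simp

lemma free_act_uminus: "free_act (- f) g = - free_act f g"
  using free_act_plus[of f "- f" g] by (simp add: free_act_0 eq_neg_iff_add_eq_0 add.commute)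

lemma free_act_diff: "free_act (f - f') g = free_act f g - free_act f' g"
  using free_act_plus[of f "- f'" g] by (simp add: free_act_uminus)

lemma free_act_mult: "free_act (f * f') g = free_act f (free_act f' g)"
proof (induction f rule: free_alg_induct)
  case (single w c)
  show ?case
    by (induction f' rule: free_alg_induct)
       (simp_all add: mult_single free_act_0 free_act_zero free_act_single free_act_plus
         free_act_add distrib_left word_act_plus word_act_smult)
qed (simp_all add: free_act_0 free_act_plus distrib_right)

lemma free_act_gen: "free_act (free_gen x) g = gen_act x g"
  by (simp add: free_gen_def free_act_single word_act_def)

lemma free_act_1: "free_act 1 g = g"
  using free_act_single[of 0 1 g] by (simp add: word_act_0)

lemma weyl_ideal_act: "f \<in> weyl_ideal \<Longrightarrow> free_act f g = 0"
proof -
  let ?K = "{f. \<forall>g. free_act f g = 0}"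
  have "two_sided_ideal ?K"
    by (auto simp: two_sided_ideal_def free_act_0 free_act_plus free_act_mult free_act_zero)
  moreover have "{free_gen P * free_gen Q - free_gen Q * free_gen P - 1} \<subseteq> ?K"
    by (auto simp: free_act_diff free_act_mult free_act_1 free_act_gen gen_act_def pderiv_pCons)
  ultimately have "weyl_ideal \<subseteq> ?K"
    unfolding weyl_ideal_def by (rule ideal_generated_minimal)
  then show "f \<in> weyl_ideal \<Longrightarrow> free_act f g = 0" by auto
qed

lift_definition weyl_act :: "'k::field weyl \<Rightarrow> 'k poly \<Rightarrow> 'k poly" is free_act
proof
  fix f f' :: "'k free_alg" and g
  assume "weyl_cong f f'"
  from weyl_ideal_act[OF this[unfolded weyl_cong_def], of g]
  show "free_act f g = free_act f' g" by (simp add: free_act_diff)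
qed

instantiation weyl :: (field) ring_1
begin

lift_definition one_weyl :: "'a weyl" is 1 .

instance
proof
  have "(1 :: 'a free_alg) \<notin> weyl_ideal"
    using weyl_ideal_act[of "1 :: 'a free_alg" 1] by (auto simp: free_act_1)
  then have "\<not> weyl_cong (0 :: 'a free_alg) 1"
    using weyl_ideal_closed(4)[of "0 - (1 :: 'a free_alg)"] by (auto simp: weyl_cong_def)
  then show "(0 :: 'a weyl) \<noteq> 1"
    by transfer
  show "1 * u = u" "u * 1 = u" for u :: "'a weyl"
    by (transfer; simp only: mult_1_left mult_1_right weyl_cong_refl)+
qed

end

lift_definition weyl_p :: "'k::field weyl" is "free_gen P" .

lift_definition weyl_q :: "'k::field weyl" is "free_gen Q" .

lift_definition weyl_scale :: "'k::field \<Rightarrow> 'k weyl \<Rightarrow> 'k weyl" is "\<lambda>c f. free_const c * f"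
  by (rule weyl_cong_mult) (auto intro: weyl_cong_refl)

lemma weyl_relation: "weyl_p * weyl_q - weyl_q * weyl_p = 1"
  by (transfer, unfold weyl_cong_def weyl_ideal_def) (use ideal_generated_superset in blast)

lemma weyl_scale_mult_left: "weyl_scale c (u * v) = weyl_scale c u * v"
  by transfer (simp only: mult.assoc weyl_cong_refl)

lemma weyl_scale_mult_right: "weyl_scale c (u * v) = u * weyl_scale c v"
proof transfer
  fix c and u v :: "'a free_alg"
  have "free_const c * (u * v) = u * (free_const c * v)"
    by (simp only: mult.assoc[symmetric] free_const_central[of c u])
  then show "weyl_cong (free_const c * (u * v)) (u * (free_const c * v))"
    by (rule weyl_cong_eqI)
qed

interpretation weyl: vector_space weyl_scale
  by (unfold_locales; transfer;
      simp only: distrib_left distrib_right free_const_add free_const_mult free_const_1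
        mult_1_left mult.assoc weyl_cong_refl)

definition weyl_poly :: "(nat \<times> nat \<Rightarrow>\<^sub>0 'k) \<Rightarrow> 'k::field weyl" where
  "weyl_poly c =
     (\<Sum>(i, j)\<in>Poly_Mapping.keys c.
        weyl_scale (Poly_Mapping.lookup c (i, j)) (weyl_p ^ i * weyl_q ^ j))"

text \<open>The coefficients exist and are unique in characteristic zero, see \<open>weyl_normal_form\<close> below.\<close>

definition weyl_coeffs :: "'k::field weyl \<Rightarrow> (nat \<times> nat \<Rightarrow>\<^sub>0 'k)" where
  "weyl_coeffs u = (THE c. u = weyl_poly c)"

text \<open>The value at \<open>0\<close> is set to \<open>0\<close>; it plays no role in the degree of an automorphism.\<close>

definition weyl_degree :: "'k::field weyl \<Rightarrow> nat" where
  "weyl_degree u =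
     (if u = 0 then 0 else Max ((\<lambda>(i, j). i + j) ` Poly_Mapping.keys (weyl_coeffs u)))"

definition aut_degree :: "('k::field weyl \<Rightarrow> 'k weyl) \<Rightarrow> nat" where
  "aut_degree \<rho> = max (weyl_degree (\<rho> weyl_p)) (weyl_degree (\<rho> weyl_q))"

lemma weyl_poly_superset:
  assumes "finite A" "Poly_Mapping.keys c \<subseteq> A"
  shows "weyl_poly c =
     (\<Sum>(i, j)\<in>A. weyl_scale (Poly_Mapping.lookup c (i, j)) (weyl_p ^ i * weyl_q ^ j))"
  unfolding weyl_poly_def using assms by (intro sum.mono_neutral_left) (auto simp: in_keys_iff)

lemma weyl_poly_0: "weyl_poly 0 = 0"
  by (simp add: weyl_poly_def)

lemma weyl_poly_single:
  "weyl_poly (Poly_Mapping.single (i, j) c) = weyl_scale c (weyl_p ^ i * weyl_q ^ j)"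
  by (subst weyl_poly_superset[of "{(i, j)}"]) auto

lemma weyl_poly_add: "weyl_poly (c + d) = weyl_poly c + weyl_poly d"
proof -
  let ?A = "Poly_Mapping.keys c \<union> Poly_Mapping.keys d"
  have "Poly_Mapping.keys (c + d) \<subseteq> ?A" by (rule Poly_Mapping.keys_add)
  then show ?thesis
    by (simp add: weyl_poly_superset[of ?A] lookup_add weyl.scale_left_distrib
        sum.distrib case_prod_unfold)
qed

lemma weyl_poly_diff: "weyl_poly (c - d) = weyl_poly c - weyl_poly d"
  using weyl_poly_add[of "c - d" d] by simp

lemma range_weyl_poly_add: "u \<in> range weyl_poly \<Longrightarrow> v \<in> range weyl_poly \<Longrightarrow> u + v \<in> range weyl_poly"
  by (auto simp flip: weyl_poly_add)

lemma range_weyl_poly_diff: "u \<in> range weyl_poly \<Longrightarrow> v \<in> range weyl_poly \<Longrightarrow> u - v \<in> range weyl_poly"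
  by (auto simp flip: weyl_poly_diff)

lemma weyl_scale_range: "u \<in> range weyl_poly \<Longrightarrow> weyl_scale a u \<in> range weyl_poly"
proof (elim rangeE, hypsubst)
  fix c :: "nat \<times> nat \<Rightarrow>\<^sub>0 'a"
  show "weyl_scale a (weyl_poly c) \<in> range weyl_poly"
  proof (induction c rule: free_alg_induct)
    case zero
    show ?case by (metis weyl_poly_0 rangeI weyl.scale_zero_right)
  next
    case (single w b)
    show ?case
      by (cases w) (metis weyl_poly_single rangeI weyl.scale_scale)
  next
    case (add f g)
    then show ?case
      by (simp add: weyl_poly_add weyl.scale_right_distrib range_weyl_poly_add)
  qed
qed

lemma weyl_commute_power: "weyl_q * weyl_p ^ i = weyl_p ^ i * weyl_q - of_nat i * weyl_p ^ (i - 1)"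
proof (induction i)
  case (Suc i)
  have qp: "weyl_q * weyl_p = weyl_p * weyl_q - (1 :: 'a weyl)"
    by (simp flip: weyl_relation)
  have *: "weyl_p * (of_nat i * weyl_p ^ (i - Suc 0)) = of_nat i * (weyl_p :: 'a weyl) ^ i"
    by (cases i) (simp, metis mult.assoc mult_of_nat_commute power_Suc diff_Suc_Suc diff_zero)
  have "weyl_q * weyl_p ^ Suc i = (weyl_q * weyl_p) * (weyl_p :: 'a weyl) ^ i"
    by (simp add: mult.assoc)
  also have "\<dots> = weyl_p * (weyl_q * weyl_p ^ i) - weyl_p ^ i"
    by (simp add: qp algebra_simps)
  also have "\<dots> = weyl_p ^ Suc i * weyl_q - of_nat (Suc i) * weyl_p ^ (Suc i - 1)"
    by (simp add: Suc right_diff_distrib * mult.assoc distrib_right algebra_simps)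
  finally show ?case .
qed simp

lemma weyl_of_nat: "of_nat n * u = weyl_scale (of_nat n) u"
  by (induction n) (simp_all add: algebra_simps weyl.scale_left_distrib)

lemma weyl_monom_range: "weyl_p ^ i * weyl_q ^ j \<in> range weyl_poly"
  using weyl_poly_single[of i j 1] by (metis rangeI weyl.scale_one)

lift_definition weyl_gen :: "gen \<Rightarrow> 'k::field weyl" is free_gen .

lemma weyl_gen_simps: "weyl_gen P = weyl_p" "weyl_gen Q = weyl_q"
  by (transfer; simp add: weyl_cong_refl)+

lemma weyl_gen_mult_range: "u \<in> range weyl_poly \<Longrightarrow> weyl_gen x * u \<in> range weyl_poly"
proof (elim rangeE, hypsubst)
  fix c :: "nat \<times> nat \<Rightarrow>\<^sub>0 'a"
  show "weyl_gen x * weyl_poly c \<in> range weyl_poly"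
  proof (induction c rule: free_alg_induct)
    case zero
    show ?case by (metis weyl_poly_0 rangeI mult_zero_right)
  next
    case (single w b)
    obtain i j where w: "w = (i, j)" by (cases w)
    have "weyl_gen x * (weyl_p ^ i * weyl_q ^ j) \<in> range weyl_poly"
    proof (cases x)
      case P
      then show ?thesis
        using weyl_monom_range[of "Suc i" j] by (simp add: weyl_gen_simps mult.assoc)
    next
      case Q
      have "weyl_gen x * (weyl_p ^ i * weyl_q ^ j) =
          weyl_p ^ i * weyl_q ^ Suc j -
          weyl_scale (of_nat i) (weyl_p ^ (i - 1) * weyl_q ^ j)"
        unfolding Q weyl_gen_simps
        by (simp add: weyl_commute_power mult.assoc[symmetric] left_diff_distrib weyl_of_nat
            weyl_scale_mult_left)
      then show ?thesis
        using weyl_monom_range weyl_scale_range range_weyl_poly_diff by metis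
    qed
    then show ?case
      using weyl_scale_range
      by (metis w weyl_poly_single weyl_scale_mult_right)
  next
    case (add f g)
    then show ?case by (simp add: weyl_poly_add distrib_left range_weyl_poly_add)
  qed
qed

lift_definition weyl_of :: "'k::field free_alg \<Rightarrow> 'k weyl" is "\<lambda>f :: 'k free_alg. f" .

lemma weyl_of_add: "weyl_of (f + g) = weyl_of f + weyl_of g"
  by transfer (rule weyl_cong_refl)

lemma weyl_of_mult: "weyl_of (f * g) = weyl_of f * weyl_of g"
  by transfer (rule weyl_cong_refl)

lemma weyl_of_0: "weyl_of 0 = 0"
  by transfer (rule weyl_cong_refl)

lemma weyl_of_1: "weyl_of 1 = 1"
  by transfer (rule weyl_cong_refl)

lemma weyl_of_gen: "weyl_of (free_gen x) = weyl_gen x"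
  by transfer (rule weyl_cong_refl)

lemma weyl_of_const_mult: "weyl_of (free_const c * f) = weyl_scale c (weyl_of f)"
  by transfer (rule weyl_cong_refl)

lemma weyl_of_surj: "\<exists>f. u = weyl_of f"
  by transfer (auto intro: weyl_cong_refl)

lemma weyl_of_word_range: "weyl_of (Poly_Mapping.single (Word xs) 1) \<in> range weyl_poly"
proof (induction xs)
  case Nil
  have "weyl_of (Poly_Mapping.single (Word []) 1) = (1 :: 'a weyl)"
    by (simp flip: zero_word_def add: weyl_of_1)
  then show ?case using weyl_monom_range[of 0 0] by simp
next
  case (Cons x xs)
  have "Poly_Mapping.single (Word (x # xs)) (1::'a) =
      free_gen x * Poly_Mapping.single (Word xs) 1"
    by (simp add: free_gen_def mult_single plus_word_def)
  then show ?case
    using Cons by (simp add: weyl_of_mult weyl_of_gen weyl_gen_mult_range)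
qed

lemma surj_weyl_poly: "u \<in> range weyl_poly"
proof -
  have "weyl_of f \<in> range weyl_poly" for f :: "'a free_alg"
  proof (induction f rule: free_alg_induct)
    case zero
    show ?case by (metis weyl_of_0 weyl_poly_0 rangeI)
  next
    case (single w c)
    have "Poly_Mapping.single w c = free_const c * Poly_Mapping.single w 1"
      by (simp add: free_const_def mult_single)
    then show ?case
      using weyl_scale_range[OF weyl_of_word_range[of "letters w"], of c]
      by (simp add: weyl_of_const_mult)
  next
    case (add f g)
    then show ?case by (simp add: weyl_of_add range_weyl_poly_add)
  qed
  then show ?thesis using weyl_of_surj[of u] by blast
qed

lemma weyl_act_simps:
  "weyl_act 0 g = 0" "weyl_act 1 g = g"
  "weyl_act (u + v) g = weyl_act u g + weyl_act v g"
  "weyl_act (u * v) g = weyl_act u (weyl_act v g)"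
  "weyl_act weyl_p g = pCons 0 g" "weyl_act weyl_q g = - pderiv g"
  by (transfer; simp add: free_act_0 free_act_1 free_act_plus free_act_mult free_act_gen
      gen_act_def)+

lemma weyl_act_scale: "weyl_act (weyl_scale c u) g = smult c (weyl_act u g)"
  by transfer (simp add: free_act_mult free_const_def free_act_single word_act_0)

lemma weyl_act_p_power: "weyl_act (weyl_p ^ i) g = monom 1 i * g"
  by (induction i) (simp_all add: weyl_act_simps monom_Suc)

lemma weyl_act_q_power: "weyl_act (weyl_q ^ j) g = (- 1) ^ j * (pderiv ^^ j) g"
proof (induction j)
  case (Suc j)
  have "pderiv ((- 1) ^ j * h) = (- 1) ^ j * pderiv h" for h :: "'a poly"
    by (cases "even j") (simp_all add: pderiv_minus)
  then show ?case by (simp add: weyl_act_simps Suc)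
qed (simp add: weyl_act_simps)

lemma weyl_act_sum: "weyl_act (\<Sum>x\<in>A. f x) g = (\<Sum>x\<in>A. weyl_act (f x) g)"
  by (induction A rule: infinite_finite_induct) (simp_all add: weyl_act_simps)

lemma pderiv_funpow_monom:
  "j \<ge> n \<Longrightarrow> (pderiv ^^ j) (monom (1::'k::field_char_0) n) = (if j = n then [:fact n:] else 0)"
proof -
  assume "j \<ge> n"
  have *: "(pderiv ^^ k) (monom (a::'k) k) = [:fact k * a:]" for k a
  proof (induction k arbitrary: a)
    case (Suc k)
    then show ?case
      by (simp add: funpow_swap1 pderiv_monom algebra_simps del: funpow.simps(2)
          flip: funpow_Suc_right) (simp add: funpow_Suc_right pderiv_monom algebra_simps del: funpow.simps)
  qed (simp add: monom_0)
  have z: "(pderiv ^^ k) (0::'k poly) = 0" for k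
    by (induction k) simp_all
  show ?thesis
  proof (cases "j = n")
    case False
    with \<open>j \<ge> n\<close> obtain k where j: "j = k + Suc n"
      by (metis add.commute add_Suc le_eq_less_or_eq less_imp_Suc_add add_Suc_right)
    have "(pderiv ^^ Suc n) (monom (1::'k) n) = 0"
      by (simp add: *)
    then show ?thesis using False unfolding j funpow_add by (simp add: z)
  qed (simp add: *)
qed

lemma weyl_poly_eq_0:
  fixes c :: "nat \<times> nat \<Rightarrow>\<^sub>0 'k::field_char_0"
  assumes "weyl_poly c = 0"
  shows "c = 0"
proof (rule ccontr)
  assume "c \<noteq> 0"
  then have ne: "Poly_Mapping.keys c \<noteq> {}" by simp
  define n where "n = Min (snd ` Poly_Mapping.keys c)"
  have min: "n \<le> j" if "(i, j) \<in> Poly_Mapping.keys c" for i j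
    unfolding n_def using that by (intro Min_le) (auto simp: image_iff intro: bexI[of _ "(i, j)"])
  have "n \<in> snd ` Poly_Mapping.keys c"
    unfolding n_def using ne by (intro Min_in) auto
  then obtain m where m: "(m, n) \<in> Poly_Mapping.keys c" by auto
  have "0 = coeff (weyl_act (weyl_poly c) (monom 1 n)) m"
    using assms by (simp add: weyl_act_simps)
  also have "\<dots> = (\<Sum>x\<in>Poly_Mapping.keys c. if x = (m, n)
        then Poly_Mapping.lookup c (m, n) * ((- 1) ^ n * fact n) else 0)"
    unfolding weyl_poly_def weyl_act_sum coeff_sum
  proof (intro sum.cong refl, clarify, goal_cases)
    case (1 i j)
    have "(- 1 :: 'k poly) ^ j = [:(- 1) ^ j:]"
      by (induction j) (simp_all add: one_pCons)
    with min[OF 1] show ?case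
      by (auto simp: weyl_act_scale weyl_act_simps(4) weyl_act_p_power weyl_act_q_power
          pderiv_funpow_monom coeff_monom_mult coeff_pCons split: nat.splits)
  qed
  also have "\<dots> = Poly_Mapping.lookup c (m, n) * ((- 1) ^ n * fact n)"
    using m by simp
  finally show False using m by (simp add: in_keys_iff)
qed

lemma weyl_normal_form: "\<exists>!c. (u :: 'k::field_char_0 weyl) = weyl_poly c"
proof (rule ex_ex1I)
  show "\<exists>c. u = weyl_poly c" using surj_weyl_poly[of u] by blast
  fix c d :: "nat \<times> nat \<Rightarrow>\<^sub>0 'k"
  assume "u = weyl_poly c" "u = weyl_poly d"
  then have "weyl_poly (c - d) = 0" by (simp add: weyl_poly_diff)
  then show "c = d" using weyl_poly_eq_0 by fastforce
qed

lemma weyl_coeffs_eqI: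
  "(u :: 'k::field_char_0 weyl) = weyl_poly c \<Longrightarrow> weyl_coeffs u = c"
  unfolding weyl_coeffs_def using weyl_normal_form[of u] by (metis (mono_tags, lifting) the1_equality)

end

theory Submission
  imports Defs
begin

text \<open>
  Write \<open>A\<close> for the Weyl algebra and \<open>ad u\<close> for the map \<open>a \<mapsto> u a - a u\<close>. Every derivation \<open>D\<close> of \<open>A\<close>
  equals \<open>ad u\<close> for some \<open>u\<close> (\<open>derivation_inner\<close>), and the degree turns products into sums, because
  leading forms multiply like commutative polynomials (\<open>weyl_degree_mult\<close>). Both directions
  rest on these two facts and on the simplicity of \<open>A\<close> (\<open>weyl_simple\<close>).

  Suppose that \<open>D = ad u\<close> is locally nilpotent and nonzero. The derivations \<open>ad (u ^ n)\<close> are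
  locally nilpotent too and commute with \<open>D\<close>, so their exponentials \<open>\<rho>\<close> are automorphisms
  commuting with \<open>D\<close>. Choose \<open>b\<close> with \<open>D b \<noteq> 0\<close> and \<open>D (D b) = 0\<close>. Then
  \<open>\<rho> b = b + n u ^ (n - 1) D b\<close>, whose degree grows with \<open>n\<close>, whereas
  \<open>deg (\<rho> b) \<le> deg b * deg \<rho>\<close>. Hence \<open>deg \<rho>\<close> is unbounded
  (\<open>locally_nilpotent_imp_large_degree\<close>).

  Suppose that \<open>D = ad u\<close> is locally finite but not locally nilpotent. Then \<open>A\<close> is the direct sum
  of the generalized eigenspaces \<open>A\<^sub>l\<close> of \<open>D\<close>; they satisfy \<open>A\<^sub>l A\<^sub>m \<subseteq> A\<^sub>l\<^sub>+\<^sub>m\<close>, and some \<open>A\<^sub>l\<close> with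
  \<open>l \<noteq> 0\<close> contains an element \<open>x \<noteq> 0\<close>. It is enough to show that, for each homogeneous \<open>a\<close>, the degree
  of \<open>\<rho> a\<close> is bounded over all automorphisms \<open>\<rho>\<close> commuting with \<open>D\<close>
  (\<open>not_locally_nilpotent_imp_bounded_degree\<close>). This takes three observations.

  \<^item> For \<open>z \<in> A\<^sub>0\<close> the products \<open>z ^ i u ^ j x ^ k\<close> with \<open>i, j, k < N\<close> number \<open>N ^ 3\<close>, but they lie in
    a space whose dimension grows only like \<open>N ^ 2\<close>. Since \<open>x ^ k\<close> has weight \<open>k l\<close>, a linear
    relation between them splits according to \<open>k\<close>, and \<open>x ^ k\<close> cancels. So \<open>z\<close> and \<open>u\<close> satisfy a
    polynomial relation (\<open>weight_zero_algebraic_relation\<close>).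

  \<^item> An automorphism \<open>\<rho>\<close> commuting with \<open>ad u\<close> adds only a scalar to \<open>u\<close>, so \<open>\<rho> u\<close> has the degree of
    \<open>u\<close>. The relation between \<open>z\<close> and \<open>u\<close> also holds between \<open>\<rho> z\<close> and \<open>\<rho> u\<close>, and it bounds
    the degree of \<open>\<rho> z\<close> (\<open>degree_bound_of_algebraic_relation\<close>).

  \<^item> For \<open>a \<noteq> 0\<close> in \<open>A\<^sub>m\<close> there is \<open>b \<noteq> 0\<close> in \<open>A\<^sub>-\<^sub>m\<close>: otherwise the spaces \<open>A\<^sub>l\<close>, for the weights
    \<open>l\<close> such that \<open>- l\<close> is not a weight, would span a proper nonzero ideal (\<open>opposite_weight\<close>). As \<open>a b\<close> lies in \<open>A\<^sub>0\<close>, the degree of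
    \<open>\<rho> a\<close> is at most that of \<open>\<rho> (a b)\<close>, which is bounded.
\<close>

section \<open>Linear relations and generalized eigenspaces\<close>

context vector_space
begin

text \<open>
  Too many vectors in a finitely generated space are linearly dependent. The family is indexed, so a
  repetition \<open>f i = f j\<close> also counts as a relation.
\<close>

lemma nontrivial_linear_relation:
  assumes "finite I" "finite T" "\<And>i. i \<in> I \<Longrightarrow> f i \<in> span T" "card T < card I"
  shows "\<exists>c. (\<exists>i\<in>I. c i \<noteq> 0) \<and> (\<Sum>i\<in>I. scale (c i) (f i)) = 0"
proof (cases "inj_on f I")
  case True
  have "f ` I \<subseteq> span T" using assms by auto
  then have "dependent (f ` I)"
    using independent_span_bound[of T "f ` I"] assms card_image[OF True] by auto
  then obtain u v where u: "v \<in> f ` I" "u v \<noteq> 0" "(\<Sum>v\<in>f ` I. scale (u v) v) = 0"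
    using dependent_finite[of "f ` I"] assms by auto
  then show ?thesis
    using True by (intro exI[of _ "u \<circ> f"]) (auto simp: sum.reindex)
next
  case False
  then obtain i j where ij: "i \<in> I" "j \<in> I" "i \<noteq> j" "f i = f j"
    by (auto simp: inj_on_def)
  define c where "c k = (if k = i then 1 else if k = j then - 1 else (0::'a))" for k
  have "(\<Sum>k\<in>I. scale (c k) (f k)) = (\<Sum>k\<in>{i, j}. scale (c k) (f k))"
    using ij assms(1) by (intro sum.mono_neutral_right) (auto simp: c_def)
  also have "\<dots> = 0" using ij by (simp add: c_def)
  finally show ?thesis using ij by (intro exI[of _ c]) (auto simp: c_def)
qed

end

locale linear_endomorphism = vector_space scale
  for scale :: "'k::field \<Rightarrow> 'v::ab_group_add \<Rightarrow> 'v" +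
  fixes D :: "'v \<Rightarrow> 'v"
  assumes map_add: "D (a + b) = D a + D b"
    and map_scale: "D (scale c a) = scale c (D a)"
begin

lemma map_zero: "D 0 = 0"
  using map_scale[of 0 0] by simp

lemma map_diff: "D (a - b) = D a - D b"
  using map_add[of "a - b" b] by (simp add: eq_diff_eq)

lemma map_sum: "D (sum f A) = (\<Sum>x\<in>A. D (f x))"
  by (induction A rule: infinite_finite_induct) (simp_all add: map_zero map_add)

lemma funpow_add_scale:
  "(D ^^ n) (a + b) = (D ^^ n) a + (D ^^ n) b" "(D ^^ n) (scale c a) = scale c ((D ^^ n) a)"
  by (induction n) (simp_all add: map_add map_scale)

lemma funpow_linear_endomorphism: "linear_endomorphism scale (D ^^ n)"
  by unfold_locales (simp_all add: funpow_add_scale)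

definition shift :: "'k \<Rightarrow> 'v \<Rightarrow> 'v" where
  "shift l a = D a - scale l a"

lemma shift_linear_endomorphism: "linear_endomorphism scale (shift l)"
  by unfold_locales (simp_all add: shift_def map_add map_scale algebra_simps)

lemma shift_commute: "shift l (shift m a) = shift m (shift l a)"
  by (simp add: shift_def map_add map_scale map_diff algebra_simps)

lemma shift_funpow_commute: "shift l ((shift m ^^ n) a) = (shift m ^^ n) (shift l a)"
  by (induction n) (simp_all add: shift_commute[of l m])

lemmas shift_zero = linear_endomorphism.map_zero[OF shift_linear_endomorphism]
lemmas shift_add = linear_endomorphism.map_add[OF shift_linear_endomorphism]
lemmas shift_scale = linear_endomorphism.map_scale[OF shift_linear_endomorphism]
lemmas shift_diff = linear_endomorphism.map_diff[OF shift_linear_endomorphism]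
lemmas shift_funpow_add_scale =
  linear_endomorphism.funpow_add_scale[OF shift_linear_endomorphism]
lemmas shift_funpow_zero = linear_endomorphism.map_zero[OF
  linear_endomorphism.funpow_linear_endomorphism[OF shift_linear_endomorphism]]
lemmas shift_funpow_sum = linear_endomorphism.map_sum[OF
  linear_endomorphism.funpow_linear_endomorphism[OF shift_linear_endomorphism]]

lemma shift_funpow_mono:
  assumes "(shift l ^^ n) a = 0" "n \<le> m"
  shows "(shift l ^^ m) a = 0"
proof -
  have "(shift l ^^ m) a = (shift l ^^ (m - n)) ((shift l ^^ n) a)"
    using assms(2) by (simp flip: funpow_add comp_apply[of "shift l ^^ (m - n)"])
  then show ?thesis by (simp add: assms(1) shift_funpow_zero)
qed

definition gen_eigenspace :: "'k \<Rightarrow> 'v set" where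
  "gen_eigenspace l = {a. \<exists>n. (shift l ^^ n) a = 0}"

lemma subspace_gen_eigenspace: "subspace (gen_eigenspace l)"
proof (rule subspaceI)
  show "0 \<in> gen_eigenspace l" by (auto simp: gen_eigenspace_def intro: exI[of _ 0])
  fix x y c assume "x \<in> gen_eigenspace l"
  then obtain n where n: "(shift l ^^ n) x = 0" by (auto simp: gen_eigenspace_def)
  then show "scale c x \<in> gen_eigenspace l"
    by (auto simp: gen_eigenspace_def shift_funpow_add_scale intro!: exI[of _ n])
  assume "y \<in> gen_eigenspace l"
  then obtain m where m: "(shift l ^^ m) y = 0" by (auto simp: gen_eigenspace_def)
  have "(shift l ^^ max n m) (x + y) = 0"
    using shift_funpow_mono[OF n, of "max n m"] shift_funpow_mono[OF m, of "max n m"]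
    by (simp add: shift_funpow_add_scale)
  then show "x + y \<in> gen_eigenspace l" by (auto simp: gen_eigenspace_def)
qed

lemma shift_gen_eigenspace: "a \<in> gen_eigenspace m \<Longrightarrow> shift l a \<in> gen_eigenspace m"
  unfolding gen_eigenspace_def by clarify (metis shift_funpow_commute shift_zero)

lemma gen_eigenspace_shift_iff: "shift l a \<in> gen_eigenspace l \<longleftrightarrow> a \<in> gen_eigenspace l"
proof
  assume "shift l a \<in> gen_eigenspace l"
  then obtain n where "(shift l ^^ n) (shift l a) = 0" by (auto simp: gen_eigenspace_def)
  then have "(shift l ^^ Suc n) a = 0" by (simp add: funpow_swap1)
  then show "a \<in> gen_eigenspace l" unfolding gen_eigenspace_def by blast
qed (rule shift_gen_eigenspace)

lemma eigenvector_gen_eigenspace: "shift l a = 0 \<Longrightarrow> a \<in> gen_eigenspace l"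
  unfolding gen_eigenspace_def by (auto intro!: exI[of _ 1])

text \<open>
  If \<open>D a = l a\<close>, then \<open>shift m\<close> multiplies \<open>a\<close> by the nonzero scalar \<open>l - m\<close>, so no power of it can
  kill \<open>a\<close> unless \<open>a = 0\<close>.
\<close>

lemma shift_inj_on_gen_eigenspace:
  assumes "a \<in> gen_eigenspace m" "l \<noteq> m" "shift l a = 0"
  shows "a = 0"
proof -
  have "shift m a = scale (l - m) a"
    using assms(3) by (simp add: shift_def algebra_simps)
  then have "(shift m ^^ n) a = scale ((l - m) ^ n) a" for n
    by (induction n) (simp_all add: shift_scale mult.commute)
  then show ?thesis using assms by (auto simp: gen_eigenspace_def)
qed

lemma shift_funpow_inj_on_gen_eigenspace:
  assumes "l \<noteq> m"
  shows "a \<in> gen_eigenspace m \<Longrightarrow> (shift l ^^ n) a = 0 \<Longrightarrow> a = 0"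
proof (induction n)
  case (Suc n)
  have "(shift l ^^ n) a \<in> gen_eigenspace m"
    using Suc.prems(1) by (induction n) (auto intro: shift_gen_eigenspace)
  then show ?case
    using shift_inj_on_gen_eigenspace[OF _ assms] Suc by simp
qed simp

text \<open>
  A power of \<open>shift (w k)\<close> removes the summand at \<open>k\<close> and is injective on all the others, so induction
  applies to the remaining sum. The weights are indexed by an arbitrary set, which lets them be
  multiples \<open>k * l\<close> of a single weight.
\<close>

lemma gen_eigenspace_independent:
  assumes "finite K" "inj_on w K" "\<And>k. k \<in> K \<Longrightarrow> a k \<in> gen_eigenspace (w k)"
    and "(\<Sum>k\<in>K. a k) = 0" "m \<in> K"
  shows "a m = 0"
  using assms
proof (induction K arbitrary: a m rule: finite_induct)
  case (insert k K)
  obtain n where n: "(shift (w k) ^^ n) (a k) = 0"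
    using insert.prems(2)[of k] by (auto simp: gen_eigenspace_def)
  have "0 = (shift (w k) ^^ n) (a k + (\<Sum>m\<in>K. a m))"
    using insert.prems(3) insert.hyps by (simp add: shift_funpow_zero)
  also have "\<dots> = (\<Sum>m\<in>K. (shift (w k) ^^ n) (a m))"
    by (simp add: shift_funpow_add_scale shift_funpow_sum n)
  finally have *: "(\<Sum>m\<in>K. (shift (w k) ^^ n) (a m)) = 0" by simp
  have G: "(shift l ^^ i) x \<in> gen_eigenspace m" if "x \<in> gen_eigenspace m" for i l x m
    using that by (induction i) (auto intro: shift_gen_eigenspace)
  have K: "a m = 0" if "m \<in> K" for m
  proof (rule shift_funpow_inj_on_gen_eigenspace)
    show "w k \<noteq> w m" using that insert.hyps insert.prems(1) by auto
    show "a m \<in> gen_eigenspace (w m)" using insert.prems that by auto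
    show "(shift (w k) ^^ n) (a m) = 0"
      using insert.IH[OF _ _ * that] insert.prems(1,2) G by auto
  qed
  then have "a k = 0" using insert.prems(3) insert.hyps by simp
  with K show ?case using insert.prems(4) by auto
qed simp

lemma span_gen_eigenspaces_sum:
  assumes "x \<in> span (\<Union>l\<in>W. gen_eigenspace l)"
  shows "\<exists>L a. finite L \<and> L \<subseteq> W \<and> (\<forall>l. a l \<in> gen_eigenspace l) \<and> x = (\<Sum>l\<in>L. a l)"
  using assms
proof (induction rule: span_induct_alt)
  case base
  show ?case
    by (intro exI[of _ "{}"] exI[of _ "\<lambda>_. 0"]) (auto simp: subspace_0[OF subspace_gen_eigenspace])
next
  case (step c x y)
  then obtain m L a where m: "m \<in> W" "x \<in> gen_eigenspace m"
    and L: "finite L" "L \<subseteq> W" "\<And>l. a l \<in> gen_eigenspace l" "y = (\<Sum>l\<in>L. a l)"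
    by blast
  define a' where "a' l = (if l = m then scale c x else 0) + (if l \<in> L then a l else 0)" for l
  have "(\<Sum>l\<in>insert m L. a' l) = scale c x + (\<Sum>l\<in>insert m L. if l \<in> L then a l else 0)"
    using L(1) unfolding a'_def sum.distrib by (subst sum.delta) auto
  also have "(\<Sum>l\<in>insert m L. if l \<in> L then a l else 0) = y"
    using L(1) unfolding L(4) by (intro sum.mono_neutral_cong_right) auto
  finally have "scale c x + y = (\<Sum>l\<in>insert m L. a' l)" by simp
  moreover have "a' l \<in> gen_eigenspace l" for l
    using m(2) L(3)[of l] unfolding a'_def
    by (auto intro!: subspace_add subspace_scale subspace_gen_eigenspace
        subspace_0[OF subspace_gen_eigenspace])
  ultimately show ?case using m L by (intro exI[of _ "insert m L"] exI[of _ a']) auto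
qed

text \<open>
  Directness of the sum, in the form that later keeps \<open>1\<close> out of an ideal spanned by weight spaces.
\<close>

lemma gen_eigenspace_Int_span_others:
  assumes "x \<in> gen_eigenspace m" "m \<notin> W" "x \<in> span (\<Union>l\<in>W. gen_eigenspace l)"
  shows "x = 0"
proof -
  obtain L a where L: "finite L" "L \<subseteq> W" "\<And>l. a l \<in> gen_eigenspace l" "x = (\<Sum>l\<in>L. a l)"
    using span_gen_eigenspaces_sum[OF assms(3)] by blast
  have m: "m \<notin> L" using L(2) assms(2) by auto
  have "(a(m := - x)) m = 0"
  proof (rule gen_eigenspace_independent[where w = "\<lambda>l. l" and K = "insert m L"
        and a = "a(m := - x)" and m = m])
    have "(\<Sum>l\<in>L. (a(m := - x)) l) = (\<Sum>l\<in>L. a l)"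
      using m by (intro sum.cong) auto
    then show "(\<Sum>l\<in>insert m L. (a(m := - x)) l) = 0"
      using L(1) m by (simp add: L(4))
  qed (use L assms(1) in \<open>auto intro: subspace_neg[OF subspace_gen_eigenspace]\<close>)
  then show ?thesis by simp
qed

text \<open>
  On the generalized eigenspace of \<open>m\<close>, the operator \<open>shift l\<close> is the sum of the nonzero scalar \<open>m - l\<close>
  and the locally nilpotent operator \<open>shift m\<close>, hence invertible. Iterating the equation for a
  preimage reduces the order of nilpotency.
\<close>

lemma shift_surj_on_gen_eigenspace:
  assumes "l \<noteq> m" "b \<in> gen_eigenspace m"
  shows "\<exists>c\<in>gen_eigenspace m. shift l c = b"
proof -
  obtain n where "(shift m ^^ n) b = 0" using assms by (auto simp: gen_eigenspace_def)
  then show ?thesis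
  proof (induction n arbitrary: b)
    case 0
    then show ?case by (auto simp: shift_zero subspace_0[OF subspace_gen_eigenspace] intro!: bexI[of _ 0])
  next
    case (Suc n)
    then have "(shift m ^^ n) (shift m b) = 0" by (simp add: funpow_swap1)
    with Suc.IH obtain c where c: "c \<in> gen_eigenspace m" "shift l c = shift m b" by blast
    have b: "b \<in> gen_eigenspace m" using Suc.prems unfolding gen_eigenspace_def by blast
    \<comment> \<open>As \<open>shift l = shift m + (m - l)\<close> and \<open>shift l c = shift m b\<close>, the difference \<open>b - c\<close> goes to \<open>(m - l) b\<close>.\<close>
    define e where "e = scale (1 / (m - l)) (b - c)"
    have "shift l (b - c) = scale (m - l) b"
      by (simp add: shift_diff c(2)) (simp add: shift_def algebra_simps)
    then have "shift l e = b" using assms(1) by (simp add: e_def shift_scale)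
    moreover have "e \<in> gen_eigenspace m"
      unfolding e_def using b c
      by (intro subspace_scale subspace_diff subspace_gen_eigenspace)
    ultimately show ?case by blast
  qed
qed

text \<open>
  This is the step that makes an annihilating polynomial with linear factors decompose a vector: the
  components of \<open>shift l a\<close> at weights other than \<open>l\<close> have preimages of the same weight, and what is
  left of \<open>a\<close> after subtracting them is killed by a power of \<open>shift l\<close>.
\<close>

lemma span_gen_eigenspaces_shift:
  assumes "shift l a \<in> span (\<Union>m. gen_eigenspace m)"
  shows "a \<in> span (\<Union>m. gen_eigenspace m)"
proof -
  let ?S = "span (\<Union>m. gen_eigenspace m)"
  \<comment> \<open>Modulo \<open>gen_eigenspace l\<close>, every element of the sum is an image under \<open>shift l\<close>.\<close>
  have *: "\<exists>c\<in>?S. b - shift l c \<in> gen_eigenspace l" if "b \<in> ?S" for b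
    using that
  proof (induction rule: span_induct_alt)
    case base
    show ?case
      by (rule bexI[of _ 0])
        (simp_all add: span_zero shift_zero subspace_0[OF subspace_gen_eigenspace])
  next
    case (step r x y)
    from step(1) obtain m where m: "x \<in> gen_eigenspace m" by blast
    from step(2) obtain c where c: "c \<in> ?S" "y - shift l c \<in> gen_eigenspace l" by blast
    have "\<exists>e\<in>?S. x - shift l e \<in> gen_eigenspace l"
    proof (cases "m = l")
      case True
      then show ?thesis using m
        by (auto simp: span_zero shift_zero intro!: bexI[of _ 0])
    next
      case False
      with shift_surj_on_gen_eigenspace[of l m x] m
      obtain e where "e \<in> gen_eigenspace m" "shift l e = x" by auto
      then show ?thesis
        by (intro bexI[of _ e]) (auto simp: subspace_0[OF subspace_gen_eigenspace] intro: span_base)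
    qed
    then obtain e where e: "e \<in> ?S" "x - shift l e \<in> gen_eigenspace l" by blast
    have "scale r x + y - shift l (scale r e + c) = scale r (x - shift l e) + (y - shift l c)"
      by (simp add: shift_add shift_scale algebra_simps)
    also have "\<dots> \<in> gen_eigenspace l"
      using e c by (intro subspace_add subspace_scale subspace_gen_eigenspace)
    finally show ?case using e c by (intro bexI[of _ "scale r e + c"]) (auto intro: span_add span_scale)
  qed
  from *[OF assms] obtain c where c: "c \<in> ?S" "shift l (a - c) \<in> gen_eigenspace l"
    by (auto simp: shift_diff)
  then have "a - c \<in> ?S" by (auto simp: gen_eigenspace_shift_iff intro: span_base)
  from span_add[OF this c(1)] show ?thesis by simp
qed

definition poly_apply :: "'k poly \<Rightarrow> 'v \<Rightarrow> 'v" where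
  "poly_apply f a = (\<Sum>i\<le>degree f. scale (coeff f i) ((D ^^ i) a))"

lemma poly_apply_superset:
  assumes "degree f \<le> n"
  shows "poly_apply f a = (\<Sum>i\<le>n. scale (coeff f i) ((D ^^ i) a))"
  unfolding poly_apply_def using assms
  by (intro sum.mono_neutral_left) (auto simp: coeff_eq_0)

lemma poly_apply_linear_factor: "poly_apply ([:- l, 1:] * f) a = poly_apply f (shift l a)"
proof -
  let ?n = "degree f"
  have 1: "degree ([:- l, 1:] * f) \<le> Suc ?n"
    by (rule order_trans[OF degree_mult_le]) simp
  have 2: "coeff ([:- l, 1:] * f) i = (case i of 0 \<Rightarrow> 0 | Suc j \<Rightarrow> coeff f j) - l * coeff f i" for i
    by (cases i) (simp_all)
  have "poly_apply ([:- l, 1:] * f) a =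
    (\<Sum>i\<le>Suc ?n. scale (case i of 0 \<Rightarrow> 0 | Suc j \<Rightarrow> coeff f j) ((D ^^ i) a))
      - (\<Sum>i\<le>Suc ?n. scale (l * coeff f i) ((D ^^ i) a))"
    unfolding poly_apply_superset[OF 1] 2 by (simp only: scale_left_diff_distrib sum_subtractf)
  also have "(\<Sum>i\<le>Suc ?n. scale (case i of 0 \<Rightarrow> 0 | Suc j \<Rightarrow> coeff f j) ((D ^^ i) a)) =
     (\<Sum>i\<le>?n. scale (coeff f i) ((D ^^ i) (D a)))"
    by (subst sum.atMost_Suc_shift) (simp add: funpow_swap1)
  also have "(\<Sum>i\<le>Suc ?n. scale (l * coeff f i) ((D ^^ i) a)) =
     (\<Sum>i\<le>?n. scale (coeff f i) ((D ^^ i) (scale l a)))"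
    by (simp add: coeff_eq_0 funpow_add_scale mult.commute)
  also have "(\<Sum>i\<le>?n. scale (coeff f i) ((D ^^ i) (D a))) - \<dots> = poly_apply f (shift l a)"
    unfolding poly_apply_def sum_subtractf[symmetric] shift_def
    by (simp add: linear_endomorphism.map_diff[OF funpow_linear_endomorphism] algebra_simps)
  finally show ?thesis .
qed

text \<open>
  Primary decomposition by induction on the degree: a root \<open>l\<close> of \<open>f\<close> splits off a factor, the quotient
  annihilates \<open>shift l a\<close>, and the decomposition of \<open>shift l a\<close> lifts to \<open>a\<close>. The first assumption says
  that the field is algebraically closed.
\<close>

lemma poly_apply_eq_0_imp_span_gen_eigenspaces:
  assumes "\<And>f :: 'k poly. degree f > 0 \<Longrightarrow> \<exists>x. poly f x = 0" "f \<noteq> 0" "poly_apply f a = 0"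
  shows "a \<in> span (\<Union>l. gen_eigenspace l)"
  using assms(2,3)
proof (induction "degree f" arbitrary: f a)
  case 0
  then obtain c where "f = [:c:]" by (metis degree_0_id of_nat_0)
  with 0 have "a = 0" by (auto simp: poly_apply_def)
  then show ?case by (simp add: span_zero)
next
  case (Suc n)
  with assms(1)[of f] obtain l where "poly f l = 0" by auto
  then obtain g where g: "f = [:- l, 1:] * g" by (auto simp: poly_eq_0_iff_dvd)
  then have "g \<noteq> 0" using Suc by auto
  then have "degree f = Suc (degree g)"
    unfolding g by (subst degree_mult_eq) auto
  with Suc \<open>g \<noteq> 0\<close> have "shift l a \<in> span (\<Union>l. gen_eigenspace l)"
    by (auto simp: g poly_apply_linear_factor simp del: mult_pCons_left)
  then show ?case by (rule span_gen_eigenspaces_shift)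
qed

lemma finite_orbit_span_imp_annihilator:
  assumes "finite B" "span B = span (range (\<lambda>n. (D ^^ n) a))"
  shows "\<exists>f. f \<noteq> 0 \<and> poly_apply f a = 0"
proof -
  have "\<exists>c. (\<exists>i\<in>{..card B}. c i \<noteq> 0) \<and> (\<Sum>i\<in>{..card B}. scale (c i) ((D ^^ i) a)) = 0"
    using assms by (intro nontrivial_linear_relation[of _ B]) (auto intro: span_base)
  then obtain c i where c: "i \<le> card B" "c i \<noteq> 0" "(\<Sum>i\<le>card B. scale (c i) ((D ^^ i) a)) = 0"
    by auto
  define f where "f = (\<Sum>i\<le>card B. monom (c i) i)"
  have f: "coeff f i = (if i \<le> card B then c i else 0)" for i
    by (simp add: f_def coeff_sum coeff_monom)
  then have "degree f \<le> card B" by (intro degree_le) auto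
  then have "poly_apply f a = (\<Sum>i\<le>card B. scale (c i) ((D ^^ i) a))"
    by (simp add: poly_apply_superset f)
  then show ?thesis using c f[of i] by (intro exI[of _ f]) auto
qed

end

section \<open>Coefficients, commutators and inner derivations\<close>

abbreviation weyl_monom :: "nat \<Rightarrow> nat \<Rightarrow> 'k::field weyl" where
  "weyl_monom i j \<equiv> weyl_p ^ i * weyl_q ^ j"

definition weyl_coeff :: "'k::field weyl \<Rightarrow> nat \<Rightarrow> nat \<Rightarrow> 'k" where
  "weyl_coeff u i j = Poly_Mapping.lookup (weyl_coeffs u) (i, j)"

lemma weyl_poly_coeffs: "weyl_poly (weyl_coeffs u) = (u :: 'k::field_char_0 weyl)"
  using weyl_normal_form[of u] weyl_coeffs_eqI by metis

lemma weyl_coeffs_poly: "weyl_coeffs (weyl_poly c) = (c :: nat \<times> nat \<Rightarrow>\<^sub>0 'k::field_char_0)"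
  by (rule weyl_coeffs_eqI) simp

lemma weyl_monom_induct [case_names monom add]:
  fixes u :: "'k::field_char_0 weyl"
  assumes "\<And>c i j. R (weyl_scale c (weyl_monom i j))"
    and "\<And>u v. R u \<Longrightarrow> R v \<Longrightarrow> R (u + v)"
  shows "R u"
proof -
  have "R (weyl_poly c)" for c :: "nat \<times> nat \<Rightarrow>\<^sub>0 'k"
  proof (induction c rule: free_alg_induct)
    case zero
    show ?case using assms(1)[of 0] by (simp add: weyl_poly_0)
  next
    case (single w c)
    then show ?case using assms(1) by (cases w) (simp add: weyl_poly_single)
  next
    case (add f g)
    then show ?case by (simp add: weyl_poly_add assms(2))
  qed
  then show ?thesis using weyl_poly_coeffs[of u] by metis
qed

context
  fixes u v :: "'k::field_char_0 weyl"
begin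

lemma weyl_coeff_add: "weyl_coeff (u + v) i j = weyl_coeff u i j + weyl_coeff v i j"
proof -
  have "weyl_coeffs (u + v) = weyl_coeffs u + weyl_coeffs v"
    by (rule weyl_coeffs_eqI) (simp add: weyl_poly_add weyl_poly_coeffs)
  then show ?thesis by (simp add: weyl_coeff_def lookup_add)
qed

lemma weyl_coeff_monom:
  "weyl_coeff (weyl_scale (c::'k) (weyl_monom a b)) i j = (if i = a \<and> j = b then c else 0)"
  by (auto simp: weyl_coeff_def lookup_single when_def weyl_coeffs_poly simp flip: weyl_poly_single)

end

lemma weyl_coeff_scale:
  fixes u :: "'k::field_char_0 weyl"
  shows "weyl_coeff (weyl_scale c u) i j = c * weyl_coeff u i j"
proof (induction u rule: weyl_monom_induct)
  case (monom d a b)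
  show ?case using weyl_coeff_monom[of "c * d" a b i j] by (simp add: weyl_coeff_monom)
qed (simp add: weyl_coeff_add weyl.scale_right_distrib algebra_simps)

lemma weyl_coeff_0: "weyl_coeff (0 :: 'k::field_char_0 weyl) i j = 0"
  using weyl_coeff_scale[of 0 "0 :: 'k weyl" i j] by simp

lemma weyl_coeff_eqI:
  fixes u v :: "'k::field_char_0 weyl"
  assumes "\<And>i j. weyl_coeff u i j = weyl_coeff v i j"
  shows "u = v"
proof -
  have "weyl_coeffs u = weyl_coeffs v"
    by (rule poly_mapping_eqI) (use assms in \<open>auto simp: weyl_coeff_def\<close>)
  then show ?thesis using weyl_poly_coeffs by metis
qed

definition ad :: "'a::ring_1 \<Rightarrow> 'a \<Rightarrow> 'a" where
  "ad u a = u * a - a * u"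

lemma ad_add: "ad u (a + b) = ad u a + ad u b" "ad (u + v) a = ad u a + ad v a"
  by (simp_all add: ad_def algebra_simps)

lemma ad_mult: "ad u (a * b) = ad u a * b + a * ad u b"
  by (simp add: ad_def algebra_simps)

lemma ad_jacobi: "ad u (ad v a) = ad v (ad u a) + ad (ad u v) a"
  by (simp add: ad_def algebra_simps)

lemma ad_scale: "ad u (weyl_scale c a) = weyl_scale c (ad u a)"
  "ad (weyl_scale c u) a = weyl_scale c (ad u a)"
  by (simp_all add: ad_def weyl.scale_right_diff_distrib
      flip: weyl_scale_mult_left weyl_scale_mult_right)

lemma ad_0: "ad u 0 = 0" "ad 0 a = 0"
  by (simp_all add: ad_def)

lemma weyl_scale_1_mult: "weyl_scale c 1 * u = weyl_scale c u" "u * weyl_scale c 1 = weyl_scale c u"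
  by (simp_all flip: weyl_scale_mult_left weyl_scale_mult_right)

lemma ad_p_q: "ad weyl_p weyl_q = 1"
  by (simp add: ad_def weyl_relation)

lemma ad_q_p_power: "ad weyl_q (weyl_p ^ i) = weyl_scale (- of_nat i) (weyl_p ^ (i - 1))"
  by (simp add: ad_def weyl_commute_power weyl_of_nat)

lemma ad_p_q_power: "ad weyl_p (weyl_q ^ j) = weyl_scale (of_nat j) (weyl_q ^ (j - 1))"
proof (induction j)
  case 0
  show ?case by (simp add: ad_def)
next
  case (Suc j)
  have *: "weyl_q * weyl_scale (of_nat j) (weyl_q ^ (j - Suc 0)) =
      weyl_scale (of_nat j) (weyl_q ^ j :: 'a weyl)"
    by (cases j) (simp_all flip: weyl_scale_mult_right)
  show ?case
    by (simp add: ad_mult ad_p_q Suc * weyl.scale_left_distrib)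
qed

lemma ad_p_monom: "ad weyl_p (weyl_monom i j) = weyl_scale (of_nat j) (weyl_monom i (j - 1))"
  by (simp add: ad_mult ad_p_q_power flip: weyl_scale_mult_right)
     (simp add: ad_def flip: power_Suc power_Suc2)

lemma ad_q_monom:
  "ad weyl_q (weyl_monom i j) = weyl_scale (- of_nat i) (weyl_monom (i - 1) j)"
proof -
  have "ad weyl_q (weyl_q ^ j :: 'a weyl) = 0"
    by (simp add: ad_def flip: power_Suc power_Suc2)
  then show ?thesis
    unfolding ad_mult ad_q_p_power by (simp flip: weyl_scale_mult_left)
qed

text \<open>
  On normal forms \<open>ad weyl_p\<close> is the partial derivative in \<open>q\<close>, and \<open>ad weyl_q\<close> is minus the partial derivative
  in \<open>p\<close>. In characteristic zero their kernels are therefore visible from the coefficients.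
\<close>

lemma weyl_coeff_ad_p:
  fixes u :: "'k::field_char_0 weyl"
  shows "weyl_coeff (ad weyl_p u) i j = of_nat (Suc j) * weyl_coeff u i (Suc j)"
proof (induction u rule: weyl_monom_induct)
  case (monom c a b)
  show ?case
    unfolding ad_scale ad_p_monom weyl.scale_scale weyl_coeff_monom
    by (cases b) (auto simp del: of_nat_Suc)
qed (simp add: ad_add weyl_coeff_add algebra_simps)

lemma weyl_coeff_ad_q:
  fixes u :: "'k::field_char_0 weyl"
  shows "weyl_coeff (ad weyl_q u) i j = - of_nat (Suc i) * weyl_coeff u (Suc i) j"
proof (induction u rule: weyl_monom_induct)
  case (monom c a b)
  have *: "ad weyl_q (weyl_scale c (weyl_monom a b)) = weyl_scale (- (c * of_nat a)) (weyl_monom (a - 1) b)"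
    by (simp only: ad_scale ad_q_monom weyl.scale_scale) simp
  show ?case
    unfolding * weyl_coeff_monom by (cases a) (auto simp del: of_nat_Suc)
qed (simp add: ad_add weyl_coeff_add algebra_simps)

lemma weyl_commutes_p_imp_span:
  fixes u :: "'k::field_char_0 weyl"
  assumes "ad weyl_p u = 0"
  shows "u \<in> weyl.span (range (\<lambda>i. weyl_p ^ i))"
proof -
  have 0: "weyl_coeff u i (Suc j) = 0" for i j
    using weyl_coeff_ad_p[of u i j] by (simp add: assms weyl_coeff_0 del: of_nat_Suc)
  have "u = weyl_poly (weyl_coeffs u)" by (simp add: weyl_poly_coeffs)
  also have "\<dots> \<in> weyl.span (range (\<lambda>i. weyl_p ^ i))"
    unfolding weyl_poly_def
  proof (intro weyl.span_sum, clarify)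
    fix i j assume "(i, j) \<in> Poly_Mapping.keys (weyl_coeffs u)"
    then have "weyl_coeff u i j \<noteq> 0" by (simp add: weyl_coeff_def in_keys_iff)
    then have "j = 0" using 0[of i "j - 1"] by (cases j) auto
    then show "weyl_scale (Poly_Mapping.lookup (weyl_coeffs u) (i, j)) (weyl_monom i j)
      \<in> weyl.span (range (\<lambda>i. weyl_p ^ i))"
      by (simp add: weyl.span_scale weyl.span_base)
  qed
  finally show ?thesis .
qed

lemma weyl_center:
  fixes u :: "'k::field_char_0 weyl"
  assumes "ad weyl_p u = 0" "ad weyl_q u = 0"
  shows "u = weyl_scale (weyl_coeff u 0 0) 1"
proof (rule weyl_coeff_eqI)
  fix i j
  have "weyl_coeff (weyl_scale (weyl_coeff u 0 0) 1) i j =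
    (if i = 0 \<and> j = 0 then weyl_coeff u 0 0 else 0)"
    using weyl_coeff_monom[of "weyl_coeff u 0 0" 0 0 i j] by simp
  moreover have "weyl_coeff u i (Suc j) = 0" for i j
    using weyl_coeff_ad_p[of u i j] by (simp add: assms weyl_coeff_0 del: of_nat_Suc)
  moreover have "weyl_coeff u (Suc i) j = 0" for i j
    using weyl_coeff_ad_q[of u i j] by (simp add: assms weyl_coeff_0 del: of_nat_Suc)
  ultimately show "weyl_coeff u i j = weyl_coeff (weyl_scale (weyl_coeff u 0 0) 1) i j"
    by (cases i; cases j) auto
qed

lemma ad_p_surj: "\<exists>v. ad weyl_p v = (u :: 'k::field_char_0 weyl)"
proof (induction u rule: weyl_monom_induct)
  case (monom c i j)
  have "ad weyl_p (weyl_scale (c / of_nat (Suc j)) (weyl_monom i (Suc j)))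
    = weyl_scale c (weyl_monom i j)"
    unfolding ad_scale ad_p_monom by (simp del: of_nat_Suc)
  then show ?case by blast
next
  case (add u v)
  then show ?case by (metis ad_add(1))
qed

text \<open>
  Integrating in \<open>p\<close> keeps a polynomial in \<open>p\<close> alone, so the primitive still commutes with \<open>p\<close>.
\<close>

lemma ad_q_surj_on_p:
  fixes u :: "'k::field_char_0 weyl"
  assumes "u \<in> weyl.span (range (\<lambda>i. weyl_p ^ i))"
  shows "\<exists>v. ad weyl_q v = u \<and> ad weyl_p v = 0"
  using assms
proof (induction rule: weyl.span_induct_alt)
  case base
  show ?case using ad_0(1) by blast
next
  case (step c x y)
  then obtain i v where i: "x = weyl_p ^ i" "ad weyl_q v = y" "ad weyl_p v = 0" by blast
  define w where "w = weyl_scale (- c / of_nat (Suc i)) (weyl_p ^ Suc i)"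
  have "ad weyl_q w = weyl_scale c x"
    unfolding w_def ad_scale ad_q_p_power by (simp add: i(1) del: of_nat_Suc)
  moreover have "ad weyl_p w = 0"
    unfolding w_def ad_scale by (simp add: ad_def flip: power_Suc power_Suc2)
  ultimately show ?case using i by (intro exI[of _ "w + v"]) (simp add: ad_add)
qed

lemma derivationD:
  assumes "derivation weyl_scale D"
  shows "D (a + b) = D a + D b" "D (weyl_scale c a) = weyl_scale c (D a)"
    "D (a * b) = D a * b + a * D b"
  using assms unfolding derivation_def
  by (auto simp: Vector_Spaces.linear_def module_hom_def module_hom_axioms_def)

lemma derivation_one:
  assumes "derivation weyl_scale D"
  shows "D 1 = 0"
  using derivationD(3)[OF assms, of 1 1] by simp

lemma derivation_eqI:
  fixes D E :: "'k::field_char_0 weyl \<Rightarrow> 'k weyl"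
  assumes D: "derivation weyl_scale D" and E: "derivation weyl_scale E"
    and pq: "D weyl_p = E weyl_p" "D weyl_q = E weyl_q"
  shows "D = E"
proof
  have pow: "D (a ^ n) = E (a ^ n)" if "D a = E a" for a n
    by (induction n) (simp_all add: derivation_one D E derivationD(3)[OF D] derivationD(3)[OF E] that)
  fix u show "D u = E u"
    by (induction u rule: weyl_monom_induct)
      (simp_all add: derivationD[OF D] derivationD[OF E] pow pq)
qed

lemma linear_weylI:
  assumes "\<And>a b. f (a + b) = f a + f b" "\<And>c a. f (weyl_scale c a) = weyl_scale c (f a)"
  shows "Vector_Spaces.linear weyl_scale weyl_scale f"
  by (intro Vector_Spaces.linear.intro module_hom.intro module_hom_axioms.intro
      weyl.vector_space_axioms weyl.module_axioms assms)

lemma derivation_ad: "derivation weyl_scale (ad u)"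
  unfolding derivation_def by (simp add: linear_weylI ad_add ad_scale ad_mult)

text \<open>
  Finding \<open>u\<close> amounts to solving \<open>ad u p = D p\<close> and \<open>ad u q = D q\<close>, that is, to finding a potential with
  prescribed partial derivatives. The integrability condition comes from applying \<open>D\<close> to
  \<open>p q - q p = 1\<close>. One integration in \<open>q\<close> gives \<open>v\<close> with the right value on \<open>p\<close>; the
  remaining error on \<open>q\<close> commutes with \<open>p\<close> and is removed by integrating in \<open>p\<close>.
\<close>

theorem derivation_inner:
  fixes D :: "'k::field_char_0 weyl \<Rightarrow> 'k weyl"
  assumes D: "derivation weyl_scale D"
  shows "\<exists>u. D = ad u"
proof -
  obtain v where v: "ad weyl_p v = - D weyl_p" using ad_p_surj by blast
  define b where "b = D weyl_q - ad v weyl_q"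
  have "D (weyl_p * weyl_q - weyl_q * weyl_p) = 0"
    by (simp only: weyl_relation derivation_one[OF D])
  then have "D (weyl_p * weyl_q) = D (weyl_q * weyl_p)"
    using derivationD(1)[OF D, of "weyl_p * weyl_q - weyl_q * weyl_p" "weyl_q * weyl_p"] by simp
  \<comment> \<open>The integrability condition for \<open>D\<close>; below, the same for \<open>ad v\<close>.\<close>
  then have 1: "ad (D weyl_p) weyl_q + ad weyl_p (D weyl_q) = 0"
    by (simp add: derivationD(3)[OF D] ad_def algebra_simps)
  have "ad weyl_p v = - ad v weyl_p" by (simp add: ad_def)
  with v have Dp: "D weyl_p = ad v weyl_p" by simp
  have "ad v (weyl_p * weyl_q - weyl_q * weyl_p) = 0"
    by (simp only: weyl_relation derivation_one[OF derivation_ad])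
  then have 2: "ad (ad v weyl_p) weyl_q + ad weyl_p (ad v weyl_q) = 0"
    by (simp add: ad_def algebra_simps)
  have "ad weyl_p b = 0"
    using 1 2 unfolding Dp b_def by (simp add: ad_def algebra_simps)
  from ad_q_surj_on_p[OF weyl_commutes_p_imp_span[OF this]]
  obtain w where w: "ad weyl_q w = b" "ad weyl_p w = 0" by blast
  have "D = ad (v - w)"
    by (rule derivation_eqI[OF D derivation_ad])
      (use w Dp in \<open>simp_all add: ad_def b_def algebra_simps\<close>)
  then show ?thesis by blast
qed

section \<open>The degree filtration and its associated graded ring\<close>

definition weyl_below :: "nat \<Rightarrow> 'k::field weyl set" where
  "weyl_below n = weyl.span {weyl_monom i j | i j. i + j < n}"

lemma subspace_weyl_below: "weyl.subspace (weyl_below n)"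
  by (simp add: weyl_below_def)

lemmas weyl_below_zero = weyl.subspace_0[OF subspace_weyl_below]
lemmas weyl_below_add = weyl.subspace_add[OF subspace_weyl_below]
lemmas weyl_below_scale = weyl.subspace_scale[OF subspace_weyl_below]

lemma weyl_below_monom: "i + j < n \<Longrightarrow> weyl_monom i j \<in> weyl_below n"
  unfolding weyl_below_def by (intro weyl.span_base) blast

lemma weyl_below_power: "i < n \<Longrightarrow> weyl_p ^ i \<in> weyl_below n" "j < n \<Longrightarrow> weyl_q ^ j \<in> weyl_below n"
  using weyl_below_monom[of i 0 n] weyl_below_monom[of 0 j n] by simp_all

lemma weyl_below_mono:
  assumes "m \<le> n" "u \<in> weyl_below m"
  shows "u \<in> weyl_below n"
proof -
  have "weyl_below m \<subseteq> weyl_below n"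
    unfolding weyl_below_def by (rule weyl.span_mono) (clarify, metis assms(1) less_le_trans)
  then show ?thesis using assms by blast
qed

lemma weyl_below_induct [consumes 1, case_names zero add]:
  assumes "u \<in> weyl_below n" "R 0"
    "\<And>c i j v. i + j < n \<Longrightarrow> R v \<Longrightarrow> R (weyl_scale c (weyl_monom i j) + v)"
  shows "R u"
  using assms(1) unfolding weyl_below_def
  by (induction rule: weyl.span_induct_alt) (use assms in auto)

lemma weyl_below_image:
  assumes "u \<in> weyl_below n"
    and "\<And>a b. f (a + b) = f a + f b" "\<And>c a. f (weyl_scale c a) = weyl_scale c (f a)"
    and "\<And>i j. i + j < n \<Longrightarrow> f (weyl_monom i j) \<in> weyl_below m"
  shows "f u \<in> weyl_below m"
  using assms(1)
proof (induction rule: weyl_below_induct)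
  case zero
  have "f 0 = 0" using assms(3)[of 0 0] by simp
  then show ?case by (simp add: weyl_below_zero)
qed (simp add: assms weyl_below_add weyl_below_scale)

lemma weyl_below_p_mult: "u \<in> weyl_below n \<Longrightarrow> weyl_p * u \<in> weyl_below (Suc n)"
proof (erule weyl_below_image)
  fix i j assume "i + j < n"
  then show "weyl_p * weyl_monom i j \<in> weyl_below (Suc n)"
    using weyl_below_monom[of "Suc i" j "Suc n"] by (simp add: mult.assoc)
qed (simp_all add: distrib_left weyl_scale_mult_right)

lemma weyl_below_mult_q: "u \<in> weyl_below n \<Longrightarrow> u * weyl_q \<in> weyl_below (Suc n)"
proof (erule weyl_below_image)
  fix i j assume "i + j < n"
  then show "weyl_monom i j * weyl_q \<in> weyl_below (Suc n)"
    using weyl_below_monom[of i "Suc j" "Suc n"] by (simp add: mult.assoc power_Suc2 del: power_Suc)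
qed (simp_all add: distrib_right weyl_scale_mult_left)

lemma weyl_below_ad_q:
  assumes "u \<in> weyl_below n"
  shows "ad weyl_q u \<in> weyl_below (n - 1)"
  using assms
proof (rule weyl_below_image)
  fix i j assume "i + j < n"
  then show "ad weyl_q (weyl_monom i j) \<in> weyl_below (n - 1)"
    unfolding ad_q_monom
    by (cases i) (auto intro!: weyl_below_scale weyl_below_monom simp: weyl_below_zero)
qed (simp_all add: ad_add ad_scale)

lemma weyl_below_ad_p:
  assumes "u \<in> weyl_below n"
  shows "ad weyl_p u \<in> weyl_below (n - 1)"
  using assms
proof (rule weyl_below_image)
  fix i j assume "i + j < n"
  then show "ad weyl_p (weyl_monom i j) \<in> weyl_below (n - 1)"
    unfolding ad_p_monom
    by (cases j) (auto intro!: weyl_below_scale weyl_below_monom simp: weyl_below_zero)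
qed (simp_all add: ad_add ad_scale)

text \<open>
  Moving \<open>q\<close> to the right, where it multiplies normal forms directly, costs a term of lower degree.
\<close>

lemma weyl_below_q_mult:
  assumes "u \<in> weyl_below n"
  shows "weyl_q * u \<in> weyl_below (Suc n)"
proof -
  have "weyl_q * u = u * weyl_q + ad weyl_q u" by (simp add: ad_def)
  then show ?thesis
    using weyl_below_mult_q[OF assms] weyl_below_mono[OF _ weyl_below_ad_q[OF assms], of "Suc n"]
    by (auto intro: weyl_below_add)
qed

lemma weyl_below_p_power_mult: "u \<in> weyl_below n \<Longrightarrow> weyl_p ^ i * u \<in> weyl_below (n + i)"
  by (induction i) (auto simp: mult.assoc dest: weyl_below_p_mult)

lemma weyl_below_mult_q_power: "u \<in> weyl_below n \<Longrightarrow> u * weyl_q ^ j \<in> weyl_below (n + j)"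
  by (induction j) (auto simp: mult.assoc[symmetric] power_Suc2 simp del: power_Suc dest: weyl_below_mult_q)

text \<open>
  Reordering \<open>q ^ j p ^ k\<close> only produces terms of degree below \<open>j + k\<close>. This is why the associated graded
  ring is commutative.
\<close>

lemma q_power_p_power_commutator_below:
  "weyl_q ^ j * weyl_p ^ k - weyl_p ^ k * weyl_q ^ j \<in> (weyl_below (j + k) :: 'k::field weyl set)"
proof (induction j)
  case 0
  show ?case by (simp add: weyl_below_zero)
next
  case (Suc j)
  have "(weyl_q :: 'k weyl) ^ Suc j * weyl_p ^ k - weyl_p ^ k * weyl_q ^ Suc j =
    weyl_q * (weyl_q ^ j * weyl_p ^ k - weyl_p ^ k * weyl_q ^ j) +
    ad weyl_q (weyl_p ^ k) * weyl_q ^ j"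
    by (simp add: ad_def algebra_simps)
  also have "\<dots> \<in> weyl_below (Suc (j + k))"
  proof (rule weyl_below_add[OF weyl_below_q_mult[OF Suc]])
    have "ad weyl_q (weyl_p ^ k) * weyl_q ^ j \<in> (weyl_below (k + 1 + j) :: 'k weyl set)"
      by (intro weyl_below_mult_q_power weyl_below_mono[OF _ weyl_below_ad_q[of _ "Suc k"]]
          weyl_below_power) simp_all
    then show "ad weyl_q (weyl_p ^ k) * weyl_q ^ j \<in> (weyl_below (Suc (j + k)) :: 'k weyl set)"
      by (simp add: ac_simps)
  qed
  finally show ?case by simp
qed

lemma weyl_monom_mult_below:
  "weyl_monom i j * weyl_monom k l - weyl_monom (i + k) (j + l)
    \<in> (weyl_below (i + j + k + l) :: 'k::field weyl set)"
proof -
  have "(weyl_monom i j :: 'k weyl) * weyl_monom k l - weyl_monom (i + k) (j + l) =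
    weyl_p ^ i * ((weyl_q ^ j * weyl_p ^ k - weyl_p ^ k * weyl_q ^ j) * weyl_q ^ l)"
    by (simp add: algebra_simps power_add)
  also have "\<dots> \<in> weyl_below (j + k + l + i)"
    by (intro weyl_below_p_power_mult weyl_below_mult_q_power q_power_p_power_commutator_below)
  finally show ?thesis by (simp add: algebra_simps)
qed

lemma weyl_coeff_below:
  fixes u :: "'k::field_char_0 weyl"
  assumes "u \<in> weyl_below n" "n \<le> i + j"
  shows "weyl_coeff u i j = 0"
  using assms(1)
  by (induction rule: weyl_below_induct)
    (use assms(2) in \<open>auto simp: weyl_coeff_0 weyl_coeff_add weyl_coeff_monom\<close>)

lemma weyl_below_iff:
  fixes u :: "'k::field_char_0 weyl"
  shows "u \<in> weyl_below n \<longleftrightarrow> (\<forall>i j. n \<le> i + j \<longrightarrow> weyl_coeff u i j = 0)"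
proof
  assume *: "\<forall>i j. n \<le> i + j \<longrightarrow> weyl_coeff u i j = 0"
  have "u = weyl_poly (weyl_coeffs u)" by (simp add: weyl_poly_coeffs)
  also have "\<dots> \<in> weyl_below n"
    unfolding weyl_poly_def
  proof (intro weyl.subspace_sum[OF subspace_weyl_below], clarify)
    fix i j assume "(i, j) \<in> Poly_Mapping.keys (weyl_coeffs u)"
    then have "weyl_coeff u i j \<noteq> 0" by (simp add: weyl_coeff_def in_keys_iff)
    then have "i + j < n" using * not_less by blast
    then show "weyl_scale (Poly_Mapping.lookup (weyl_coeffs u) (i, j)) (weyl_monom i j) \<in> weyl_below n"
      by (intro weyl_below_scale weyl_below_monom)
  qed
  finally show "u \<in> weyl_below n" .
qed (use weyl_coeff_below in blast)

lemma weyl_below_0: "u \<in> weyl_below 0 \<longleftrightarrow> (u :: 'k::field_char_0 weyl) = 0"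
  by (auto simp: weyl_below_iff weyl_coeff_0 intro: weyl_coeff_eqI)

lemma weyl_degree_le_iff:
  fixes u :: "'k::field_char_0 weyl"
  shows "weyl_degree u \<le> d \<longleftrightarrow> u \<in> weyl_below (Suc d)"
proof (cases "u = 0")
  case False
  have "weyl_coeffs u \<noteq> 0"
    using False weyl_poly_coeffs[of u] by (auto simp: weyl_poly_0)
  then have "weyl_degree u \<le> d \<longleftrightarrow> (\<forall>(i, j)\<in>Poly_Mapping.keys (weyl_coeffs u). i + j \<le> d)"
    using False by (simp add: weyl_degree_def split_beta)
  also have "\<dots> \<longleftrightarrow> u \<in> weyl_below (Suc d)"
    unfolding weyl_below_iff by (force simp: weyl_coeff_def in_keys_iff Suc_le_eq not_less[symmetric])
  finally show ?thesis .
qed (simp add: weyl_degree_def weyl_below_zero)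

text \<open>
  The component of degree \<open>n\<close> is a form in \<open>p\<close> and \<open>q\<close>. It is stored dehomogenized, with \<open>q\<close> set to \<open>1\<close>,
  as a polynomial in one variable: no information is lost since \<open>n\<close> is known, and these
  polynomials form an integral domain.
\<close>

definition symbol :: "nat \<Rightarrow> 'k::field weyl \<Rightarrow> 'k poly" where
  "symbol n u = (\<Sum>i\<le>n. monom (weyl_coeff u i (n - i)) i)"

lemma coeff_symbol: "coeff (symbol n u) i = (if i \<le> n then weyl_coeff u i (n - i) else 0)"
  by (simp add: symbol_def coeff_sum)

context
  fixes u v :: "'k::field_char_0 weyl"
begin

lemma symbol_add: "symbol n (u + v) = symbol n u + symbol n v"
  by (rule poly_eqI) (simp add: coeff_symbol weyl_coeff_add)

lemma symbol_scale: "symbol n (weyl_scale c u) = smult c (symbol n u)"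
  by (rule poly_eqI) (simp add: coeff_symbol weyl_coeff_scale)

lemma symbol_below: "u \<in> weyl_below n \<Longrightarrow> symbol n u = 0"
  by (rule poly_eqI) (simp add: coeff_symbol weyl_coeff_below)

lemma symbol_eq_0_imp_below:
  assumes "u \<in> weyl_below (Suc n)" "symbol n u = 0"
  shows "u \<in> weyl_below n"
  unfolding weyl_below_iff
proof (intro allI impI)
  fix i j assume "n \<le> i + j"
  show "weyl_coeff u i j = 0"
  proof (cases "n = i + j")
    case True
    then show ?thesis using coeff_symbol[of n u i] assms(2) by simp
  next
    case False
    then show ?thesis using weyl_coeff_below[OF assms(1), of i j] \<open>n \<le> i + j\<close> by simp
  qed
qed

end

lemma symbol_0: "symbol n (0 :: 'k::field_char_0 weyl) = 0"
  by (simp add: symbol_below weyl_below_zero)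

lemma symbol_monom:
  "symbol n (weyl_monom i j :: 'k::field_char_0 weyl) = (if i + j = n then monom 1 i else 0)"
  using weyl_coeff_monom[of "1 :: 'k" i j]
  by (intro poly_eqI) (auto simp: coeff_symbol)

lemma weyl_below_mult:
  fixes u v :: "'k::field weyl"
  assumes "u \<in> weyl_below m" "v \<in> weyl_below (Suc n)"
  shows "u * v \<in> weyl_below (m + n)"
  using assms(1)
proof (rule weyl_below_image)
  fix i j assume ij: "i + j < m"
  show "weyl_monom i j * v \<in> weyl_below (m + n)"
    using assms(2)
  proof (rule weyl_below_image)
    fix k l assume kl: "k + l < Suc n"
    have "weyl_monom i j * weyl_monom k l - weyl_monom (i + k) (j + l) + weyl_monom (i + k) (j + l)
      \<in> weyl_below (m + n)"
      using ij kl
      by (intro weyl_below_add weyl_below_mono[OF _ weyl_monom_mult_below] weyl_below_monom) auto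
    then show "weyl_monom i j * weyl_monom k l \<in> weyl_below (m + n)" by simp
  qed (simp_all add: algebra_simps weyl_scale_mult_right)
qed (simp_all add: algebra_simps weyl_scale_mult_left)

text \<open>
  The leading monomial of a product of monomials is the commutative product, and the rest has lower
  degree, hence symbol \<open>0\<close>. Bilinearity does the rest.
\<close>

lemma symbol_mult:
  fixes u v :: "'k::field_char_0 weyl"
  assumes "u \<in> weyl_below (Suc m)" "v \<in> weyl_below (Suc n)"
  shows "symbol (m + n) (u * v) = symbol m u * symbol n v"
  using assms(1)
proof (induction rule: weyl_below_induct)
  case zero
  show ?case by (simp add: symbol_0)
next
  case (add c i j w)
  have "symbol (m + n) (weyl_monom i j * v) = symbol m (weyl_monom i j :: 'k weyl) * symbol n v"
    using assms(2)
  proof (induction rule: weyl_below_induct)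
    case zero
    show ?case by (simp add: symbol_0)
  next
    case (add d k l w)
    have "weyl_monom i j * weyl_monom k l - weyl_monom (i + k) (j + l)
      \<in> (weyl_below (m + n) :: 'k weyl set)"
      using \<open>i + j < Suc m\<close> \<open>k + l < Suc n\<close>
      by (intro weyl_below_mono[OF _ weyl_monom_mult_below]) auto
    from symbol_below[OF this]
    have "symbol (m + n) (weyl_monom i j * weyl_monom k l) =
        symbol (m + n) (weyl_monom (i + k) (j + l) :: 'k weyl)"
      using symbol_add[of "m + n" "weyl_monom i j * weyl_monom k l - weyl_monom (i + k) (j + l)"
          "weyl_monom (i + k) (j + l) :: 'k weyl"] by simp
    also have "\<dots> = symbol m (weyl_monom i j :: 'k weyl) * symbol n (weyl_monom k l)"
      using \<open>i + j < Suc m\<close> \<open>k + l < Suc n\<close> by (auto simp: symbol_monom mult_monom)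
    finally show ?case
      using add.IH by (simp add: distrib_left symbol_add symbol_scale flip: weyl_scale_mult_right)
  qed
  then show ?case
    using add.IH by (simp add: distrib_right symbol_add symbol_scale flip: weyl_scale_mult_left)
qed

lemma weyl_degree_below: "(u :: 'k::field_char_0 weyl) \<in> weyl_below (Suc (weyl_degree u))"
  using weyl_degree_le_iff by blast

lemma weyl_degree_mult_le:
  fixes u v :: "'k::field_char_0 weyl"
  assumes "weyl_degree u \<le> m" "weyl_degree v \<le> n"
  shows "weyl_degree (u * v) \<le> m + n"
  using weyl_below_mult[of u "Suc m" v n] assms by (simp add: weyl_degree_le_iff)

lemma weyl_degree_power_le:
  fixes u :: "'k::field_char_0 weyl"
  assumes "weyl_degree u \<le> m"
  shows "weyl_degree (u ^ n) \<le> n * m"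
proof (induction n)
  case 0
  show ?case unfolding weyl_degree_le_iff using weyl_below_monom[of 0 0 1] by simp
next
  case (Suc n)
  then show ?case using weyl_degree_mult_le[OF assms Suc] by simp
qed

lemma symbol_degree_nonzero:
  fixes u :: "'k::field_char_0 weyl"
  assumes "u \<noteq> 0"
  shows "symbol (weyl_degree u) u \<noteq> 0"
proof
  assume "symbol (weyl_degree u) u = 0"
  then have "u \<in> weyl_below (weyl_degree u)"
    by (rule symbol_eq_0_imp_below[OF weyl_degree_below])
  then show False
    using assms weyl_degree_le_iff[of u "weyl_degree u - 1"]
    by (cases "weyl_degree u") (auto simp: weyl_below_0)
qed

text \<open>
  The symbols of \<open>u\<close> and \<open>v\<close> in their own degrees are nonzero, and their product is the symbol
  of \<open>u * v\<close>.
\<close>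

theorem weyl_degree_mult:
  fixes u v :: "'k::field_char_0 weyl"
  assumes "u \<noteq> 0" "v \<noteq> 0"
  shows "u * v \<noteq> 0" "weyl_degree (u * v) = weyl_degree u + weyl_degree v"
proof -
  let ?d = "weyl_degree u + weyl_degree v"
  have s: "symbol ?d (u * v) \<noteq> 0"
    using symbol_mult[OF weyl_degree_below weyl_degree_below, of u v] assms
    by (simp add: symbol_degree_nonzero)
  then show "u * v \<noteq> 0" by (auto simp: symbol_0)
  have "weyl_degree (u * v) \<le> ?d"
    unfolding weyl_degree_le_iff
    using weyl_below_mult[OF weyl_degree_below weyl_degree_below, of u v] by simp
  moreover have "\<not> weyl_degree (u * v) < ?d"
    using s symbol_below[OF weyl_below_mono[OF _ weyl_degree_below], of "u * v" ?d] by (auto simp: Suc_le_eq)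
  ultimately show "weyl_degree (u * v) = ?d" by simp
qed

lemma weyl_power_nonzero_degree:
  fixes u :: "'k::field_char_0 weyl"
  assumes "u \<noteq> 0"
  shows "u ^ n \<noteq> 0" "weyl_degree (u ^ n) = n * weyl_degree u"
proof -
  have "weyl_degree (1 :: 'k weyl) \<le> 0"
    unfolding weyl_degree_le_iff using weyl_below_monom[of 0 0 1] by simp
  then have "u ^ n \<noteq> 0 \<and> weyl_degree (u ^ n) = n * weyl_degree u"
    by (induction n) (simp_all add: assms weyl_degree_mult)
  then show "u ^ n \<noteq> 0" "weyl_degree (u ^ n) = n * weyl_degree u" by auto
qed

lemma weyl_degree_add_le:
  fixes u v :: "'k::field_char_0 weyl"
  shows "weyl_degree (u + v) \<le> max (weyl_degree u) (weyl_degree v)"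
  unfolding weyl_degree_le_iff
  by (intro weyl_below_add weyl_below_mono[OF _ weyl_degree_below]) auto

lemma weyl_degree_scale:
  fixes u :: "'k::field_char_0 weyl"
  assumes "c \<noteq> 0"
  shows "weyl_degree (weyl_scale c u) = weyl_degree u"
proof -
  have "weyl_degree (weyl_scale c v) \<le> weyl_degree v" for v :: "'k weyl" and c
    unfolding weyl_degree_le_iff by (intro weyl_below_scale weyl_degree_below)
  from this[of c u] this[of "1 / c" "weyl_scale c u"] show ?thesis using assms by simp
qed

text \<open>
  Only the summand of the largest degree \<open>d\<close> contributes to the symbol in degree \<open>d\<close>.
\<close>

lemma sum_distinct_degrees_nonzero:
  fixes f :: "'b \<Rightarrow> 'k::field_char_0 weyl"
  assumes "finite A" "A \<noteq> {}" "\<And>x. x \<in> A \<Longrightarrow> f x \<noteq> 0" "inj_on (\<lambda>x. weyl_degree (f x)) A"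
  shows "sum f A \<noteq> 0"
proof -
  define d where "d = Max ((\<lambda>x. weyl_degree (f x)) ` A)"
  have "d \<in> (\<lambda>x. weyl_degree (f x)) ` A" unfolding d_def using assms by (intro Max_in) auto
  then obtain x where x: "x \<in> A" "weyl_degree (f x) = d" by auto
  have "f y \<in> weyl_below d" if "y \<in> A - {x}" for y
  proof -
    have "weyl_degree (f y) \<le> d" unfolding d_def using that assms(1) by (intro Max_ge) auto
    moreover have "weyl_degree (f y) \<noteq> d"
      using that x assms(4) by (auto simp: inj_on_def)
    ultimately show ?thesis by (intro weyl_below_mono[OF _ weyl_degree_below]) auto
  qed
  then have "sum f (A - {x}) \<in> weyl_below d"
    by (intro weyl.subspace_sum[OF subspace_weyl_below])
  then have "symbol d (sum f A) = symbol d (f x)"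
    using x(1) assms(1) by (simp add: sum.remove symbol_add symbol_below)
  also have "\<dots> \<noteq> 0" using x assms(3) symbol_degree_nonzero by metis
  finally show ?thesis by (auto simp: symbol_0)
qed

lemma weyl_degree_0_imp_scalar:
  fixes u :: "'k::field_char_0 weyl"
  assumes "weyl_degree u = 0"
  shows "u = weyl_scale (weyl_coeff u 0 0) 1"
proof -
  have "u \<in> weyl_below 1" using weyl_degree_below[of u] assms by simp
  then show ?thesis
    using weyl_below_ad_p[of u 1] weyl_below_ad_q[of u 1] by (intro weyl_center) (auto simp: weyl_below_0)
qed

text \<open>
  Commutators with \<open>p\<close> and with \<open>q\<close> stay in the ideal and lower the degree. A nonzero element of
  minimal degree therefore commutes with both, so it is a nonzero scalar.
\<close>

theorem weyl_simple:
  fixes I :: "'k::field_char_0 weyl set"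
  assumes I: "two_sided_ideal I" and u: "u \<in> I" "u \<noteq> 0"
  shows "1 \<in> I"
proof -
  have adI: "ad x v \<in> I" if "v \<in> I" for x v
    using that I unfolding ad_def by (intro two_sided_ideal_diff[OF I]) (auto simp: two_sided_ideal_def)
  define v where "v = (ARG_MIN weyl_degree v. v \<in> I \<and> v \<noteq> 0)"
  have v: "v \<in> I" "v \<noteq> 0" and min: "\<And>w. w \<in> I \<Longrightarrow> w \<noteq> 0 \<Longrightarrow> weyl_degree v \<le> weyl_degree w"
    using arg_min_nat_lemma[of "\<lambda>v. v \<in> I \<and> v \<noteq> 0" u weyl_degree] u unfolding v_def by auto
  have 0: "ad x v = 0" if "ad x v \<in> weyl_below (weyl_degree v)" for x
  proof (rule ccontr)
    assume "ad x v \<noteq> 0"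
    then have "weyl_degree v \<le> weyl_degree (ad x v)" using min adI v by auto
    moreover have "weyl_degree v \<noteq> 0"
      using that \<open>ad x v \<noteq> 0\<close> by (auto simp: weyl_below_0 intro!: Nat.gr0I)
    ultimately show False
      using that weyl_degree_le_iff[of "ad x v" "weyl_degree v - 1"] by auto
  qed
  have v_eq: "v = weyl_scale (weyl_coeff v 0 0) 1"
    using weyl_below_ad_p[OF weyl_degree_below[of v]] weyl_below_ad_q[OF weyl_degree_below[of v]] 
    by (intro weyl_center 0) auto
  define c where "c = weyl_coeff v 0 0"
  have "c \<noteq> 0" using v(2) v_eq by (auto simp: c_def)
  have "1 = weyl_scale (1 / c) v"
    using \<open>c \<noteq> 0\<close> unfolding c_def by (subst v_eq) simp
  also have "\<dots> = weyl_scale (1 / c) 1 * v" by (simp add: weyl_scale_1_mult)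
  also have "\<dots> \<in> I" using I v(1) by (auto simp: two_sided_ideal_def)
  finally show ?thesis .
qed

lemma finite_spanning_below:
  "\<exists>T. finite T \<and> card T \<le> n ^ 2 \<and> weyl_below n = weyl.span T"
proof (intro exI conjI)
  let ?S = "{(i, j). i + j < n}" and ?T = "{weyl_monom i j | i j. i + j < n} :: 'a weyl set"
  have S: "?S \<subseteq> {..<n} \<times> {..<n}" by auto
  then have fin: "finite ?S" by (rule finite_subset) simp
  have T: "?T = (\<lambda>(i, j). weyl_monom i j) ` ?S" by auto
  show "finite ?T" unfolding T using fin by simp
  have "card ?T \<le> card ?S" unfolding T using fin by (rule card_image_le)
  also have "\<dots> \<le> card ({..<n} \<times> {..<n})" by (rule card_mono[OF _ S]) simp
  finally show "card ?T \<le> n ^ 2" by (simp add: power2_eq_square)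
qed (simp add: weyl_below_def)

section \<open>Exponentials of locally nilpotent derivations\<close>

lemma derivation_linear_endomorphism:
  "derivation weyl_scale D \<Longrightarrow> linear_endomorphism weyl_scale D"
  by unfold_locales (simp_all add: derivationD)

text \<open>
  Divided powers \<open>E ^ n / n!\<close> turn the Leibniz rule into a plain convolution.
\<close>

definition divided_power :: "('k::field_char_0 weyl \<Rightarrow> 'k weyl) \<Rightarrow> nat \<Rightarrow> 'k weyl \<Rightarrow> 'k weyl" where
  "divided_power E n a = weyl_scale (1 / fact n) ((E ^^ n) a)"

text \<open>
  The exponential series cut off at the order of nilpotency of \<open>a\<close>; any later cut gives the same sum.
\<close>

definition nil_exp :: "('k::field_char_0 weyl \<Rightarrow> 'k weyl) \<Rightarrow> 'k weyl \<Rightarrow> 'k weyl" where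
  "nil_exp E a = (\<Sum>n<(LEAST n. (E ^^ n) a = 0). divided_power E n a)"

locale locally_nilpotent_derivation =
  fixes E :: "'k::field_char_0 weyl \<Rightarrow> 'k weyl"
  assumes derivation: "derivation weyl_scale E"
    and locally_nilpotent: "locally_nilpotent E"
begin

sublocale linear_endomorphism weyl_scale E
  by (rule derivation_linear_endomorphism) (rule derivation)

lemma funpow_eq_0_mono:
  assumes "(E ^^ n) a = 0" "n \<le> m"
  shows "(E ^^ m) a = 0"
proof -
  have "(E ^^ m) a = (E ^^ (m - n)) ((E ^^ n) a)"
    using assms(2) by (simp flip: funpow_add comp_apply[of "E ^^ (m - n)"])
  then show ?thesis
    using assms(1) linear_endomorphism.map_zero[OF funpow_linear_endomorphism] by simp
qed

lemma divided_power_eq_0: "(E ^^ N) a = 0 \<Longrightarrow> N \<le> n \<Longrightarrow> divided_power E n a = 0"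
  by (simp add: divided_power_def funpow_eq_0_mono)

lemma nil_exp_eq:
  assumes "(E ^^ N) a = 0"
  shows "nil_exp E a = (\<Sum>n<N. divided_power E n a)"
  unfolding nil_exp_def
proof (rule sum.mono_neutral_left)
  show "{..<LEAST n. (E ^^ n) a = 0} \<subseteq> {..<N}"
    using assms by (auto intro: less_le_trans Least_le)
  have "(E ^^ (LEAST n. (E ^^ n) a = 0)) a = 0" using assms by (rule LeastI)
  then show "\<forall>n\<in>{..<N} - {..<LEAST n. (E ^^ n) a = 0}. divided_power E n a = 0"
    by (auto intro: divided_power_eq_0)
qed simp

lemma eventually_zero: obtains N where "(E ^^ N) a = 0" "(E ^^ N) b = 0"
proof -
  obtain n m where "(E ^^ n) a = 0" "(E ^^ m) b = 0"
    using locally_nilpotent unfolding locally_nilpotent_def by metis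
  then have "(E ^^ max n m) a = 0" "(E ^^ max n m) b = 0"
    by (auto intro: funpow_eq_0_mono)
  then show ?thesis by (rule that)
qed

lemma derivation_divided_power:
  "E (divided_power E n a) = weyl_scale (of_nat (Suc n)) (divided_power E (Suc n) a)"
  by (simp add: divided_power_def map_scale del: of_nat_Suc)

lemma divided_power_mult:
  "divided_power E n (a * b) = (\<Sum>i\<le>n. divided_power E i a * divided_power E (n - i) b)"
proof (induction n)
  case 0
  show ?case by (simp add: divided_power_def)
next
  case (Suc n)
  \<comment> \<open>Differentiating the convolution of order \<open>n\<close> gives each \<open>g i\<close> twice, with factors \<open>i\<close> and \<open>Suc n - i\<close>.\<close>
  define g where "g i = divided_power E i a * divided_power E (Suc n - i) b" for i
  have "weyl_scale (of_nat (Suc n)) (divided_power E (Suc n) (a * b)) =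
      E (\<Sum>i\<le>n. divided_power E i a * divided_power E (n - i) b)"
    by (simp only: derivation_divided_power[symmetric] Suc)
  also have "\<dots> = (\<Sum>i\<le>n. weyl_scale (of_nat (Suc i)) (g (Suc i))) +
      (\<Sum>i\<le>n. weyl_scale (of_nat (Suc n - i)) (g i))"
    unfolding map_sum sum.distrib[symmetric]
  proof (intro sum.cong refl)
    fix i assume "i \<in> {..n}"
    then have i: "Suc n - i = Suc (n - i)" by auto
    show "E (divided_power E i a * divided_power E (n - i) b) =
        weyl_scale (of_nat (Suc i)) (g (Suc i)) + weyl_scale (of_nat (Suc n - i)) (g i)"
      unfolding derivationD(3)[OF derivation] derivation_divided_power g_def i diff_Suc_Suc
      by (simp only: weyl_scale_mult_left[symmetric] weyl_scale_mult_right[symmetric])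
  qed
  also have "(\<Sum>i\<le>n. weyl_scale (of_nat (Suc i)) (g (Suc i))) =
      (\<Sum>i\<le>Suc n. weyl_scale (of_nat i) (g i))"
    by (subst sum.atMost_Suc_shift) (simp del: of_nat_Suc)
  also have "(\<Sum>i\<le>n. weyl_scale (of_nat (Suc n - i)) (g i)) =
      (\<Sum>i\<le>Suc n. weyl_scale (of_nat (Suc n - i)) (g i))"
    by simp
  also have "(\<Sum>i\<le>Suc n. weyl_scale (of_nat i) (g i)) + \<dots> =
      weyl_scale (of_nat (Suc n)) (\<Sum>i\<le>Suc n. g i)"
    unfolding sum.distrib[symmetric] weyl.scale_sum_right
    by (intro sum.cong refl) (simp only: weyl.scale_left_distrib[symmetric] of_nat_add[symmetric], simp)
  finally show ?case
    unfolding g_def by (simp only: weyl.scale_cancel_left) (simp del: of_nat_Suc)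
qed

lemma nil_exp_add: "nil_exp E (a + b) = nil_exp E a + nil_exp E b"
proof -
  obtain N where N: "(E ^^ N) a = 0" "(E ^^ N) b = 0" by (rule eventually_zero)
  then have "(E ^^ N) (a + b) = 0" by (simp add: funpow_add_scale)
  then show ?thesis
    using N by (simp add: nil_exp_eq[of N] divided_power_def funpow_add_scale
        weyl.scale_right_distrib sum.distrib)
qed

lemma nil_exp_scale: "nil_exp E (weyl_scale c a) = weyl_scale c (nil_exp E a)"
proof -
  obtain N where N: "(E ^^ N) a = 0" by (rule eventually_zero)
  then have "(E ^^ N) (weyl_scale c a) = 0" by (simp add: funpow_add_scale)
  then show ?thesis
    using N by (simp add: nil_exp_eq[of N] divided_power_def funpow_add_scale
        weyl.scale_sum_right mult.commute)
qed

lemma nil_exp_one: "nil_exp E 1 = 1"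
  using nil_exp_eq[of 1 1] by (simp add: derivation_one[OF derivation] divided_power_def)

text \<open>
  The Cauchy product of two finite series. With \<open>N\<close> bounding the orders of both factors, the triangle
  \<open>i + j < 2 * N\<close> contains the square of all nonzero terms.
\<close>

lemma nil_exp_mult: "nil_exp E (a * b) = nil_exp E a * nil_exp E b"
proof -
  obtain N where N: "(E ^^ N) a = 0" "(E ^^ N) b = 0" by (rule eventually_zero)
  let ?g = "\<lambda>i j. divided_power E i a * divided_power E j b"
  have 0: "?g i j = 0" if "\<not> (i < N \<and> j < N)" for i j
    using that N by (auto simp: divided_power_eq_0 not_less)
  have "divided_power E (2 * N) (a * b) = 0"
    unfolding divided_power_mult by (intro sum.neutral ballI 0) auto
  then have "(E ^^ (2 * N)) (a * b) = 0" by (simp add: divided_power_def)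
  then have "nil_exp E (a * b) = (\<Sum>n<2 * N. \<Sum>i\<le>n. ?g i (n - i))"
    by (simp add: nil_exp_eq[of "2 * N"] divided_power_mult)
  also have "\<dots> = (\<Sum>(i, j)\<in>{(i, j). i + j < 2 * N}. ?g i j)"
    by (rule sum.triangle_reindex[symmetric])
  also have "\<dots> = (\<Sum>(i, j)\<in>{..<N} \<times> {..<N}. ?g i j)"
  proof (rule sum.mono_neutral_right)
    show "finite {(i, j). i + j < 2 * N}"
      by (rule finite_subset[of _ "{..<2 * N} \<times> {..<2 * N}"]) auto
    show "\<forall>x\<in>{(i, j). i + j < 2 * N} - {..<N} \<times> {..<N}. (case x of (i, j) \<Rightarrow> ?g i j) = 0"
      using 0 by auto
  qed auto
  also have "\<dots> = nil_exp E a * nil_exp E b"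
    using N by (simp add: nil_exp_eq[of N] sum_product sum.cartesian_product)
  finally show ?thesis .
qed

text \<open>
  The exponential is the identity plus a map that lowers the order of nilpotency, so preimages exist by
  induction on that order.
\<close>

lemma nil_exp_surj: "a \<in> range (nil_exp E)"
proof -
  obtain N where "(E ^^ N) a = 0" by (rule eventually_zero)
  then show ?thesis
  proof (induction N arbitrary: a)
    case 0
    then show ?case using nil_exp_scale[of 0 0] by (auto intro!: image_eqI[of _ _ 0])
  next
    case (Suc N)
    have eq: "nil_exp E a = a + (\<Sum>n<N. divided_power E (Suc n) a)"
      unfolding nil_exp_eq[OF Suc.prems]
      by (subst sum.lessThan_Suc_shift) (simp add: divided_power_def)
    have "(E ^^ N) (\<Sum>n<N. divided_power E (Suc n) a) = 0"
      unfolding linear_endomorphism.map_sum[OF funpow_linear_endomorphism]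
    proof (intro sum.neutral ballI)
      fix n
      have "(E ^^ N) ((E ^^ Suc n) a) = (E ^^ (N + Suc n)) a"
        by (simp only: funpow_add comp_apply)
      also have "\<dots> = 0" by (rule funpow_eq_0_mono[OF Suc.prems]) simp
      finally show "(E ^^ N) (divided_power E (Suc n) a) = 0"
        unfolding divided_power_def funpow_add_scale by simp
    qed
    from Suc.IH[OF this] obtain b where b: "nil_exp E a = a + nil_exp E b"
      unfolding eq by auto
    have "nil_exp E (a - b) + nil_exp E b = a + nil_exp E b"
      using b nil_exp_add[of "a - b" b] by simp
    then show ?case by (intro image_eqI[of _ _ "a - b"]) simp_all
  qed
qed

text \<open>
  The kernel is a two-sided ideal without \<open>1\<close>.
\<close>

lemma nil_exp_inj: "inj (nil_exp E)"
proof (rule injI)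
  fix a b assume *: "nil_exp E a = nil_exp E b"
  define I where "I = {a. nil_exp E a = 0}"
  have "two_sided_ideal I"
    using nil_exp_scale[of 0 0]
    by (auto simp: two_sided_ideal_def I_def nil_exp_add nil_exp_mult)
  moreover have "a - b \<in> I" using nil_exp_add[of "a - b" b] * by (simp add: I_def)
  moreover have "1 \<notin> I" by (simp add: I_def nil_exp_one)
  ultimately show "a = b" using weyl_simple[of I "a - b"] by auto
qed

theorem nil_exp_algebra_aut: "nil_exp E \<in> algebra_aut weyl_scale"
  using nil_exp_inj nil_exp_surj
  by (auto simp: algebra_aut_def bij_def nil_exp_one nil_exp_mult intro!: linear_weylI nil_exp_add nil_exp_scale)

lemma nil_exp_commute:
  assumes D: "linear_endomorphism weyl_scale D" and DE: "\<And>a. D (E a) = E (D a)"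
  shows "D (nil_exp E a) = nil_exp E (D a)"
proof -
  have pow: "D ((E ^^ n) a) = (E ^^ n) (D a)" for n
    by (induction n) (simp_all add: DE)
  obtain N where N: "(E ^^ N) a = 0" by (rule eventually_zero)
  then have "(E ^^ N) (D a) = 0"
    by (simp flip: pow add: linear_endomorphism.map_zero[OF D])
  then show ?thesis
    using N by (simp add: nil_exp_eq[of N] linear_endomorphism.map_sum[OF D] divided_power_def
        linear_endomorphism.map_scale[OF D] pow)
qed

end

section \<open>Locally nilpotent derivations commute with automorphisms of large degree\<close>

lemma algebra_autD:
  assumes "\<rho> \<in> algebra_aut weyl_scale"
  shows "\<rho> (a + b) = \<rho> a + \<rho> b" "\<rho> (weyl_scale c a) = weyl_scale c (\<rho> a)"
    "\<rho> (a * b) = \<rho> a * \<rho> b" "\<rho> 1 = 1" "\<rho> (a ^ n) = \<rho> a ^ n" "\<rho> 0 = 0"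
    "\<rho> (a - b) = \<rho> a - \<rho> b" "\<rho> a = 0 \<longleftrightarrow> a = 0" "\<exists>x. a = \<rho> x"
proof -
  have *: "\<rho> (a + b) = \<rho> a + \<rho> b" "\<rho> (weyl_scale c a) = weyl_scale c (\<rho> a)"
    "\<rho> (a * b) = \<rho> a * \<rho> b" "\<rho> 1 = 1" "bij \<rho>" for a b c
    using assms unfolding algebra_aut_def
    by (auto simp: Vector_Spaces.linear_def module_hom_def module_hom_axioms_def)
  show "\<rho> (a + b) = \<rho> a + \<rho> b" "\<rho> (weyl_scale c a) = weyl_scale c (\<rho> a)"
    "\<rho> (a * b) = \<rho> a * \<rho> b" "\<rho> 1 = 1" by (fact *)+
  show "\<rho> (a ^ n) = \<rho> a ^ n" by (induction n) (simp_all add: *)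
  show 0: "\<rho> 0 = 0" using *(2)[of 0 0] by simp
  show "\<rho> (a - b) = \<rho> a - \<rho> b" using *(1)[of "a - b" b] by simp
  show "\<rho> a = 0 \<longleftrightarrow> a = 0" using bij_is_inj[OF *(5)] 0 by (metis injD)
  show "\<exists>x. a = \<rho> x" using bij_is_surj[OF *(5)] by (metis surjD)
qed

lemma algebra_aut_sum:
  assumes "\<rho> \<in> algebra_aut weyl_scale"
  shows "\<rho> (sum f A) = (\<Sum>x\<in>A. \<rho> (f x))"
  by (induction A rule: infinite_finite_induct) (simp_all add: algebra_autD[OF assms])

text \<open>
  Substituting \<open>\<rho> p\<close> and \<open>\<rho> q\<close> into a monomial multiplies its degree by at most the degree of \<open>\<rho>\<close>.
\<close>

lemma weyl_degree_aut_le: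
  fixes \<rho> :: "'k::field_char_0 weyl \<Rightarrow> 'k weyl"
  assumes \<rho>: "\<rho> \<in> algebra_aut weyl_scale"
  shows "weyl_degree (\<rho> u) \<le> weyl_degree u * aut_degree \<rho>"
  unfolding weyl_degree_le_iff using weyl_degree_below[of u]
proof (rule weyl_below_image)
  fix i j assume ij: "i + j < Suc (weyl_degree u)"
  have "weyl_degree (\<rho> (weyl_monom i j)) \<le> i * aut_degree \<rho> + j * aut_degree \<rho>"
    unfolding algebra_autD[OF \<rho>]
    by (intro weyl_degree_mult_le weyl_degree_power_le) (simp_all add: aut_degree_def)
  also have "\<dots> \<le> weyl_degree u * aut_degree \<rho>"
    using ij by (simp flip: add_mult_distrib)
  finally show "\<rho> (weyl_monom i j) \<in> weyl_below (Suc (weyl_degree u * aut_degree \<rho>))"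
    by (simp only: weyl_degree_le_iff)
qed (simp_all add: algebra_autD[OF \<rho>])

lemma locally_nilpotentE:
  assumes "locally_nilpotent D"
  obtains n where "n \<ge> 1" "(D ^^ n) a = 0"
  using assms by (auto simp: locally_nilpotent_def)

text \<open>
  Left and right multiplication by \<open>u\<close> commute with \<open>ad u\<close>, and \<open>ad (u ^ n)\<close> is a sum of terms
  \<open>u ^ i (ad u a) u ^ j\<close>. So each application of \<open>ad (u ^ n)\<close> uses up one power of \<open>ad u\<close>.
\<close>

lemma locally_nilpotent_ad_power:
  fixes u :: "'k::field_char_0 weyl"
  assumes "locally_nilpotent (ad u)"
  shows "locally_nilpotent (ad (u ^ n))"
proof -
  interpret linear_endomorphism weyl_scale "ad u"
    by (rule derivation_linear_endomorphism) (rule derivation_ad)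
  have L: "(ad u ^^ m) (u * a) = u * (ad u ^^ m) a"  "(ad u ^^ m) (a * u ^ n) = (ad u ^^ m) a * u ^ n"
    for m a n
    by (induction m) (simp_all add: ad_def algebra_simps power_commutes)
  have step: "(ad u ^^ m) (ad (u ^ n) a) = 0" if "(ad u ^^ Suc m) a = 0" for m a
  proof (induction n)
    case 0
    have "ad (u ^ 0) a = 0" by (simp add: ad_def)
    then show ?case by (simp add: linear_endomorphism.map_zero[OF funpow_linear_endomorphism])
  next
    case (Suc n)
    have "ad (u ^ Suc n) a = u * ad (u ^ n) a + ad u a * u ^ n"
      by (simp add: ad_def algebra_simps)
    then show ?case
      using that Suc by (simp add: funpow_add_scale L funpow_swap1)
  qed
  have nil: "(ad (u ^ n) ^^ m) a = 0" if "(ad u ^^ m) a = 0" for m a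
    using that
  proof (induction m arbitrary: a)
    case (Suc m)
    have "(ad (u ^ n) ^^ m) (ad (u ^ n) a) = 0" by (rule Suc.IH[OF step[OF Suc.prems]])
    then show ?case by (simp add: funpow_swap1)
  qed simp
  show ?thesis
    unfolding locally_nilpotent_def
  proof
    fix a
    obtain m where "m \<ge> 1" "(ad u ^^ m) a = 0" by (rule locally_nilpotentE[OF assms, of a])
    then show "\<exists>m\<ge>1. (ad (u ^ n) ^^ m) a = 0" by (intro exI[of _ m] conjI nil)
  qed
qed

lemma ad_power_of_commuting:
  assumes "u * ad u b = ad u b * u"
  shows "ad (u ^ Suc n) b = of_nat (Suc n) * (u ^ n * ad u b)"
proof (induction n)
  case (Suc n)
  have "ad u b * u ^ k = u ^ k * ad u b" for k
    by (rule power_commuting_commutes[OF assms, symmetric])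
  moreover have "ad (u ^ Suc (Suc n)) b = u * ad (u ^ Suc n) b + ad u b * u ^ Suc n"
    by (simp add: ad_def algebra_simps)
  moreover have "u * (of_nat (Suc n) * (u ^ n * ad u b)) = of_nat (Suc n) * (u ^ Suc n * ad u b)"
    by (simp only: mult.assoc[symmetric] mult_of_nat_commute[of _ u, symmetric] power_Suc)
  ultimately show ?case
    unfolding Suc by (simp only: of_nat_Suc[of "Suc n"] distrib_right mult_1_left add.commute)
qed simp

text \<open>
  The automorphism is the exponential of \<open>ad (u ^ Suc n)\<close>. On an element \<open>b\<close> with \<open>D b \<noteq> 0\<close> and \<open>D (D b) = 0\<close> the
  series has only two terms, and the second one, a multiple of \<open>u ^ n * D b\<close>, has degree at least \<open>n\<close>.
\<close>

theorem locally_nilpotent_imp_large_degree: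
  fixes D :: "'k::field_char_0 weyl \<Rightarrow> 'k weyl"
  assumes D: "derivation weyl_scale D" and nil: "locally_nilpotent D" and "D \<noteq> (\<lambda>_. 0)"
  shows "\<exists>\<rho>\<in>aut_commuting weyl_scale D. aut_degree \<rho> \<ge> d"
proof -
  obtain u where u: "D = ad u" using derivation_inner[OF D] by blast
  obtain a where a: "D a \<noteq> 0" using assms(3) by blast
  define m where "m = (LEAST m. (D ^^ m) a = 0)"
  obtain m' where "(D ^^ m') a = 0" by (rule locally_nilpotentE[OF nil, of a])
  then have m: "(D ^^ m) a = 0" unfolding m_def by (rule LeastI)
  have less: "(D ^^ k) a \<noteq> 0" if "k < m" for k
    using not_less_Least[of k "\<lambda>m. (D ^^ m) a = 0"] that unfolding m_def by auto
  have "a \<noteq> 0" using a derivationD(2)[OF D, of 0 0] by auto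
  have "m \<noteq> 0" using m \<open>a \<noteq> 0\<close> by (metis funpow_0)
  moreover have "m \<noteq> Suc 0" using m a by (intro notI) simp
  ultimately obtain k where k: "m = Suc (Suc k)" by (metis not0_implies_Suc)
  define b where "b = (D ^^ k) a"
  have b: "D b \<noteq> 0" "D (D b) = 0" using m less[of "Suc k"] by (auto simp: b_def k)
  then have "u * ad u b = ad u b * u" unfolding u by (simp add: ad_def)
  note comm = ad_power_of_commuting[OF this]
  have deg_u: "weyl_degree u \<ge> 1"
  proof (rule ccontr)
    assume "\<not> weyl_degree u \<ge> 1"
    then obtain c where "u = weyl_scale c 1" using weyl_degree_0_imp_scalar[of u] by auto
    then show False using b(1) by (simp add: u ad_def weyl_scale_1_mult)
  qed
  then have "u \<noteq> 0" by (auto simp: weyl_degree_def)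
  \<comment> \<open>Large enough to exceed both \<open>weyl_degree b\<close>, so that \<open>b\<close> cannot cancel the second term, and \<open>weyl_degree b * d\<close>.\<close>
  define n where "n = weyl_degree b * d + weyl_degree b + 1"
  define E where "E = ad (u ^ Suc n)"
  interpret locally_nilpotent_derivation E
    unfolding E_def
    by (intro locally_nilpotent_derivation.intro derivation_ad
        locally_nilpotent_ad_power[OF nil[unfolded u]])
  let ?v = "weyl_scale (of_nat (Suc n)) (u ^ n * D b)"
  have Eb: "E b = ?v"
    unfolding E_def comm u weyl_of_nat ..
  have "u * D b = D b * u" using b(2) unfolding u by (simp add: ad_def)
  then have uDb: "u ^ Suc n * D b = D b * u ^ Suc n" by (rule power_commuting_commutes)
  have "u ^ Suc n * (u ^ n * D b) = u ^ n * (u ^ Suc n * D b)"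
    by (simp only: mult.assoc[symmetric] power_add[symmetric] add.commute)
  also have "\<dots> = u ^ n * D b * u ^ Suc n"
    unfolding uDb by (simp only: mult.assoc)
  finally have "ad (u ^ Suc n) (u ^ n * D b) = 0" by (simp add: ad_def)
  then have "E (E b) = 0" unfolding Eb by (simp add: E_def ad_scale)
  then have rho_b: "nil_exp E b = b + ?v"
    using nil_exp_eq[of 2 b] by (simp add: Eb divided_power_def numeral_2_eq_2)
  have deg_v: "weyl_degree ?v = n * weyl_degree u + weyl_degree (D b)"
    using \<open>u \<noteq> 0\<close> b(1)
    by (simp add: weyl_degree_scale weyl_degree_mult weyl_power_nonzero_degree del: of_nat_Suc)
  have "n \<le> weyl_degree ?v" unfolding deg_v using deg_u by (simp add: trans_le_add1)
  also have "weyl_degree ?v \<le> max (weyl_degree (nil_exp E b)) (weyl_degree (weyl_scale (-1) b))"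
    using weyl_degree_add_le[of "nil_exp E b" "weyl_scale (-1) b"] by (simp add: rho_b)
  also have "weyl_degree (weyl_scale (-1) b) = weyl_degree b" by (rule weyl_degree_scale) simp
  finally have "n \<le> weyl_degree (nil_exp E b)" by (simp add: n_def)
  also have "\<dots> \<le> weyl_degree b * aut_degree (nil_exp E)"
    by (rule weyl_degree_aut_le[OF nil_exp_algebra_aut])
  finally have "weyl_degree b * d < weyl_degree b * aut_degree (nil_exp E)"
    unfolding n_def by linarith
  then have "d \<le> aut_degree (nil_exp E)" by simp
  moreover have "nil_exp E \<in> aut_commuting weyl_scale D"
  proof -
    have "ad u (u ^ Suc n) = 0" by (simp add: ad_def mult.assoc power_commutes)
    then have "D (E a) = E (D a)" for a
      unfolding u E_def ad_jacobi[of u "u ^ Suc n"] by (simp add: ad_0)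
    then have "D (nil_exp E a) = nil_exp E (D a)" for a
      by (intro nil_exp_commute derivation_linear_endomorphism D)
    then show ?thesis using nil_exp_algebra_aut by (auto simp: aut_commuting_def)
  qed
  ultimately show ?thesis by blast
qed

section \<open>The grading by weights and the automorphisms commuting with a derivation\<close>

locale weyl_derivation =
  fixes D :: "'k::field_char_0 weyl \<Rightarrow> 'k weyl"
  assumes derivation: "derivation weyl_scale D"
begin

sublocale linear_endomorphism weyl_scale D
  by (rule derivation_linear_endomorphism) (rule derivation)

lemma shift_mult: "shift (l + m) (a * b) = shift l a * b + a * shift m b"
  by (simp add: shift_def derivationD(3)[OF derivation] weyl.scale_left_distrib
      left_diff_distrib right_diff_distrib flip: weyl_scale_mult_left weyl_scale_mult_right)

text \<open>
  By the Leibniz rule \<open>shift_mult\<close>, applying \<open>shift (l + m)\<close> to a product lowers the order of nilpotency of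
  one of the factors.
\<close>

lemma gen_eigenspace_mult:
  assumes "a \<in> gen_eigenspace l" "b \<in> gen_eigenspace m"
  shows "a * b \<in> gen_eigenspace (l + m)"
proof -
  obtain i j where "(shift l ^^ i) a = 0" "(shift m ^^ j) b = 0"
    using assms by (auto simp: gen_eigenspace_def)
  then show ?thesis
  proof (induction "i + j" arbitrary: i j a b)
    case 0
    then show ?case by (simp add: weyl.subspace_0[OF subspace_gen_eigenspace])
  next
    case (Suc n)
    show ?case
    proof (cases "i = 0 \<or> j = 0")
      case True
      then have "a * b = 0" using Suc.prems by auto
      then show ?thesis by (simp add: weyl.subspace_0[OF subspace_gen_eigenspace])
    next
      case False
      then obtain i' j' where ij: "i = Suc i'" "j = Suc j'" by (metis not0_implies_Suc)
      have "shift l a * b \<in> gen_eigenspace (l + m)"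
        by (rule Suc.hyps(1)[of i' j]) (use Suc ij in \<open>simp_all add: funpow_swap1\<close>)
      moreover have "a * shift m b \<in> gen_eigenspace (l + m)"
        by (rule Suc.hyps(1)[of i j']) (use Suc ij in \<open>simp_all add: funpow_swap1\<close>)
      ultimately have "shift (l + m) (a * b) \<in> gen_eigenspace (l + m)"
        unfolding shift_mult by (intro weyl.subspace_add[OF subspace_gen_eigenspace])
      then show ?thesis by (simp add: gen_eigenspace_shift_iff)
    qed
  qed
qed

lemma one_gen_eigenspace: "1 \<in> gen_eigenspace 0"
  by (rule eigenvector_gen_eigenspace) (simp add: shift_def derivation_one[OF derivation])

lemma power_gen_eigenspace: "a \<in> gen_eigenspace l \<Longrightarrow> a ^ n \<in> gen_eigenspace (of_nat n * l)"
proof (induction n)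
  case 0
  show ?case by (simp add: one_gen_eigenspace)
next
  case (Suc n)
  then have "a * a ^ n \<in> gen_eigenspace (l + of_nat n * l)" by (intro gen_eigenspace_mult) auto
  then show ?case by (simp add: algebra_simps)
qed

text \<open>
  Call a weight \<open>l\<close> one-sided if \<open>- l\<close> is not a weight. If \<open>l\<close> is one-sided and \<open>k\<close> is any weight, then \<open>l + k\<close> is
  one-sided: a nonzero element of weight \<open>- (l + k)\<close> times one of weight \<open>k\<close> would have weight \<open>- l\<close>
  and be nonzero, as \<open>A\<close> is a domain. So the one-sided weight spaces span an ideal. It does not contain \<open>1\<close>,
  which has the weight \<open>0 = - 0\<close>; by simplicity it is zero.
\<close>

lemma opposite_weight:
  assumes span: "weyl.span (\<Union>l. gen_eigenspace l) = UNIV"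
    and a: "a \<in> gen_eigenspace m" "a \<noteq> 0"
  shows "\<exists>b\<in>gen_eigenspace (- m). b \<noteq> 0"
proof (rule ccontr)
  assume no: "\<not> (\<exists>b\<in>gen_eigenspace (- m). b \<noteq> 0)"
  \<comment> \<open>The one-sided weights.\<close>
  define W where "W = {l. gen_eigenspace l \<noteq> {0} \<and> gen_eigenspace (- l) = {0}}"
  have 0: "0 \<in> gen_eigenspace l" for l by (rule weyl.subspace_0[OF subspace_gen_eigenspace])
  define I where "I = weyl.span (\<Union>l\<in>W. gen_eigenspace l)"
  have homog: "x * y \<in> I \<and> y * x \<in> I"
    if l: "l \<in> W" and x: "x \<in> gen_eigenspace l" and y: "y \<in> gen_eigenspace k" for l k x y
  proof (cases "x = 0 \<or> y = 0")
    case False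
    have "gen_eigenspace (- (l + k)) = {0}"
    proof (rule ccontr)
      assume "gen_eigenspace (- (l + k)) \<noteq> {0}"
      then obtain z where z: "z \<in> gen_eigenspace (- (l + k))" "z \<noteq> 0" using 0 by blast
      have "z * y \<in> gen_eigenspace (- (l + k) + k)" by (rule gen_eigenspace_mult[OF z(1) y])
      moreover have "z * y \<noteq> 0" using z False by (simp add: weyl_degree_mult)
      ultimately show False using l by (auto simp: W_def)
    qed
    moreover have "x * y \<in> gen_eigenspace (l + k)" "y * x \<in> gen_eigenspace (l + k)"
      using gen_eigenspace_mult[OF x y] gen_eigenspace_mult[OF y x] by (simp_all add: add.commute)
    moreover have "x * y \<noteq> 0" using False by (simp add: weyl_degree_mult)
    ultimately show ?thesis unfolding I_def W_def by (blast intro: weyl.span_base)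
  qed (auto simp: I_def weyl.span_zero)
  have ideal: "x * y \<in> I \<and> y * x \<in> I" if "x \<in> I" for x y
  proof -
    have "x \<in> weyl.span (\<Union>l\<in>W. gen_eigenspace l)" using that by (simp add: I_def)
    moreover have "y \<in> weyl.span (\<Union>l. gen_eigenspace l)" by (simp add: span)
    then have "x * y \<in> I \<and> y * x \<in> I" if "l \<in> W" "x \<in> gen_eigenspace l" for x l
    proof (induction rule: weyl.span_induct_alt)
      case base
      show ?case by (simp add: I_def weyl.span_zero)
    next
      case (step c z y)
      with homog[OF that, of z] show ?case
        by (auto simp: I_def distrib_left distrib_right simp flip: weyl_scale_mult_left
            weyl_scale_mult_right intro!: weyl.span_add weyl.span_scale)
    qed
    ultimately show ?thesis
    proof (induction rule: weyl.span_induct_alt)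
      case base
      show ?case by (simp add: I_def weyl.span_zero)
    next
      case (step c z x)
      then show ?case
        by (auto simp: I_def distrib_left distrib_right simp flip: weyl_scale_mult_left
            weyl_scale_mult_right intro!: weyl.span_add weyl.span_scale)
    qed
  qed
  have "two_sided_ideal I"
    unfolding two_sided_ideal_def using ideal by (auto simp: I_def weyl.span_zero weyl.span_add)
  moreover have "m \<in> W" using no a 0[of "- m"] by (auto simp: W_def)
  then have "a \<in> I" using a unfolding I_def by (blast intro: weyl.span_base)
  ultimately have "1 \<in> I" using weyl_simple a(2) by blast
  moreover have "0 \<notin> W" by (auto simp: W_def)
  ultimately have "1 = (0 :: 'k weyl)"
    unfolding I_def by (intro gen_eigenspace_Int_span_others[OF one_gen_eigenspace])
  then show False by simp
qed

text \<open>
  The monomials \<open>z ^ i * h ^ j * x ^ k\<close> with exponents below \<open>N\<close> have degree at most \<open>N * s\<close>, where \<open>s\<close> is the sum of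
  the three degrees. They are \<open>N ^ 3\<close> in number, more than the at most \<open>(N * s + 1) ^ 2\<close> monomials that span
  this range of degrees. The resulting relation is separated into its parts of weight \<open>k * l\<close>.
\<close>

lemma weight_zero_algebraic_relation:
  assumes z: "z \<in> gen_eigenspace 0" and h: "h \<in> gen_eigenspace 0"
    and x: "x \<in> gen_eigenspace l" "l \<noteq> 0" "x \<noteq> 0"
  shows "\<exists>N c. (\<exists>i<N. \<exists>j<N. c (i, j) \<noteq> 0) \<and>
    (\<Sum>(i, j)\<in>{..<N} \<times> {..<N}. weyl_scale (c (i, j)) (z ^ i * h ^ j)) = 0"
proof -
  define s where "s = weyl_degree z + weyl_degree h + weyl_degree x"
  \<comment> \<open>This choice gives \<open>(N * s + 1) ^ 2 \<le> N ^ 2 * (s + 1) ^ 2 < N ^ 3\<close>.\<close>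
  define N where "N = Suc ((s + 1) ^ 2)"
  define f where "f = (\<lambda>((i, j), k). z ^ i * h ^ j * x ^ k)"
  let ?IJ = "{..<N} \<times> {..<N}"
  obtain T :: "'k weyl set" where
    T: "finite T" "card T \<le> Suc (N * s) ^ 2" "weyl_below (Suc (N * s)) = weyl.span T"
    using finite_spanning_below by blast
  have deg: "f y \<in> weyl.span T" if "y \<in> ?IJ \<times> {..<N}" for y
  proof -
    obtain i j k where y: "y = ((i, j), k)" by (metis prod.exhaust)
    have "weyl_degree (f y) \<le> i * weyl_degree z + j * weyl_degree h + k * weyl_degree x"
      unfolding f_def y by (auto intro!: weyl_degree_mult_le weyl_degree_power_le)
    also have "\<dots> \<le> N * weyl_degree z + N * weyl_degree h + N * weyl_degree x"
      using that unfolding y by (intro add_mono mult_right_mono) auto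
    finally show ?thesis by (simp add: weyl_degree_le_iff s_def algebra_simps flip: T(3))
  qed
  have "Suc (N * s) ^ 2 \<le> (N * (s + 1)) ^ 2" by (rule power_mono) (auto simp: N_def)
  also have "\<dots> < N ^ 2 * N" unfolding power_mult_distrib by (simp add: N_def)
  also have "\<dots> = card (?IJ \<times> {..<N})" by (simp add: card_cartesian_product power2_eq_square)
  finally have "card T < card (?IJ \<times> {..<N})" using T(2) by simp
  from weyl.nontrivial_linear_relation[where f = f, OF _ T(1) deg this]
  obtain c where c: "\<exists>y\<in>?IJ \<times> {..<N}. c y \<noteq> 0" "(\<Sum>y\<in>?IJ \<times> {..<N}. weyl_scale (c y) (f y)) = 0"
    by blast
  then obtain i j k where ijk: "i < N" "j < N" "k < N" "c ((i, j), k) \<noteq> 0" by auto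
  \<comment> \<open>The coefficient of \<open>x ^ k\<close> in the relation; it has weight \<open>0\<close>.\<close>
  define a where "a k = (\<Sum>(i, j)\<in>?IJ. weyl_scale (c ((i, j), k)) (z ^ i * h ^ j))" for k
  have a: "a k \<in> gen_eigenspace 0" for k
    unfolding a_def
  proof (intro weyl.subspace_sum[OF subspace_gen_eigenspace], clarify)
    fix i j
    have "z ^ i * h ^ j \<in> gen_eigenspace (of_nat i * 0 + of_nat j * 0)"
      by (intro gen_eigenspace_mult power_gen_eigenspace z h)
    then show "weyl_scale (c ((i, j), k)) (z ^ i * h ^ j) \<in> gen_eigenspace 0"
      by (simp add: weyl.subspace_scale[OF subspace_gen_eigenspace])
  qed
  have "a k * x ^ k = 0"
  proof (rule gen_eigenspace_independent[where K = "{..<N}" and w = "\<lambda>k. of_nat k * l"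
        and a = "\<lambda>k. a k * x ^ k" and m = k])
    show "inj_on (\<lambda>k. of_nat k * l) {..<N}" using x(2) by (auto intro: inj_onI)
    show "a k * x ^ k \<in> gen_eigenspace (of_nat k * l)" for k
      using gen_eigenspace_mult[OF a[of k] power_gen_eigenspace[OF x(1), of k]] by simp
    have "(\<Sum>k<N. a k * x ^ k) = (\<Sum>k<N. \<Sum>y\<in>?IJ. weyl_scale (c (y, k)) (f (y, k)))"
      by (intro sum.cong refl)
        (simp add: a_def f_def sum_distrib_right split_beta weyl_scale_mult_left)
    also have "\<dots> = (\<Sum>y\<in>?IJ \<times> {..<N}. weyl_scale (c y) (f y))"
      by (subst sum.swap) (simp add: sum.cartesian_product split_beta)
    finally show "(\<Sum>k<N. a k * x ^ k) = 0" using c(2) by simp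
  qed (use ijk in auto)
  then have "a k = 0" using weyl_degree_mult(1) weyl_power_nonzero_degree(1)[OF x(3)] by blast
  then show ?thesis
    unfolding a_def using ijk by (intro exI[of _ N] exI[of _ "\<lambda>y. c (y, k)"]) auto
qed

end

text \<open>
  If \<open>deg z > N * deg h\<close>, then the numbers \<open>i * deg z + j * deg h\<close> with \<open>j < N\<close> determine \<open>i\<close> by division
  with remainder, and then \<open>j\<close>. So the terms of the relation have distinct degrees and cannot
  cancel.
\<close>

lemma degree_bound_of_algebraic_relation:
  fixes z h :: "'k::field_char_0 weyl"
  assumes rel: "(\<Sum>(i, j)\<in>{..<N} \<times> {..<N}. weyl_scale (c (i, j)) (z ^ i * h ^ j)) = 0"
    and nontriv: "i < N" "j < N" "c (i, j) \<noteq> 0" and h: "weyl_degree h \<ge> 1"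
  shows "weyl_degree z \<le> N * weyl_degree h"
proof (rule ccontr)
  assume "\<not> ?thesis"
  then have z: "weyl_degree z > N * weyl_degree h" by simp
  have "z \<noteq> 0" "h \<noteq> 0" using z h by (auto simp: weyl_degree_def)
  define A where "A = {y \<in> {..<N} \<times> {..<N}. c y \<noteq> 0}"
  define f where "f = (\<lambda>(i, j). weyl_scale (c (i, j)) (z ^ i * h ^ j))"
  have deg: "f y \<noteq> 0 \<and> weyl_degree (f y) = fst y * weyl_degree z + snd y * weyl_degree h" if "y \<in> A" for y
    using that \<open>z \<noteq> 0\<close> \<open>h \<noteq> 0\<close>
    by (auto simp: A_def f_def weyl_degree_scale weyl_degree_mult weyl_power_nonzero_degree split: prod.splits)
  have small: "snd y * weyl_degree h < weyl_degree z" if "y \<in> A" for y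
  proof -
    have "snd y * weyl_degree h \<le> N * weyl_degree h" using that by (auto simp: A_def)
    then show ?thesis using z by linarith
  qed
  have "sum f A \<noteq> 0"
  proof (rule sum_distinct_degrees_nonzero)
    show "finite A" by (simp add: A_def)
    show "A \<noteq> {}" using nontriv by (auto simp: A_def)
    show "f y \<noteq> 0" if "y \<in> A" for y using deg[OF that] by simp
    show "inj_on (\<lambda>y. weyl_degree (f y)) A"
    proof (rule inj_onI)
      fix y y' assume y: "y \<in> A" "y' \<in> A" "weyl_degree (f y) = weyl_degree (f y')"
      then have eq: "fst y * weyl_degree z + snd y * weyl_degree h =
          fst y' * weyl_degree z + snd y' * weyl_degree h" using deg by auto
      have "fst y = (fst y * weyl_degree z + snd y * weyl_degree h) div weyl_degree z"
        using small[OF y(1)] by simp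
      also have "\<dots> = fst y'" unfolding eq using small[OF y(2)] by simp
      finally show "y = y'" using eq h by (intro prod_eqI) auto
    qed
  qed
  moreover have "sum f A = (\<Sum>y\<in>{..<N} \<times> {..<N}. f y)"
    unfolding A_def by (intro sum.mono_neutral_left) (auto simp: f_def)
  ultimately show False using rel by (simp add: f_def)
qed

text \<open>
  Commuting with \<open>ad u\<close> forces \<open>ad (\<rho> u) = ad u\<close>, so \<open>\<rho> u - u\<close> is central, and the center consists of scalars.
\<close>

lemma aut_commuting_ad_shift:
  fixes u :: "'k::field_char_0 weyl"
  assumes "\<rho> \<in> aut_commuting weyl_scale (ad u)"
  shows "\<exists>c. \<rho> u = u + weyl_scale c 1"
proof -
  have \<rho>: "\<rho> \<in> algebra_aut weyl_scale" and comm: "\<And>a. \<rho> (ad u a) = ad u (\<rho> a)"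
    using assms by (auto simp: aut_commuting_def fun_eq_iff)
  have "ad b (\<rho> u - u) = 0" for b
  proof -
    obtain a where b: "b = \<rho> a" using algebra_autD(9)[OF \<rho>] by blast
    have "ad (\<rho> u) b = ad u b"
      unfolding b using comm[of a] by (simp add: ad_def algebra_autD[OF \<rho>])
    then show ?thesis by (simp add: ad_def algebra_simps)
  qed
  then obtain c where "\<rho> u - u = weyl_scale c 1" using weyl_center by blast
  then show ?thesis by (metis add_diff_cancel_left' diff_add_cancel add.commute)
qed

text \<open>
  The bound is found for \<open>a\<close> of weight \<open>0\<close> from its relation with \<open>u\<close>, then for homogeneous \<open>a\<close> by
  multiplying with an element of opposite weight, and then for sums of homogeneous elements.
\<close>

theorem not_locally_nilpotent_imp_bounded_degree:
  fixes D :: "'k::{alg_closed_field,field_char_0} weyl \<Rightarrow> 'k weyl"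
  assumes D: "derivation weyl_scale D" and fin: "locally_finite weyl_scale D"
    and not_nil: "\<not> locally_nilpotent D"
  shows "\<exists>B. \<forall>\<rho>\<in>aut_commuting weyl_scale D. weyl_degree (\<rho> a) \<le> B"
proof -
  interpret weyl_derivation D by unfold_locales (rule D)
  obtain u where u: "D = ad u" using derivation_inner[OF D] by blast
  have "x \<in> weyl.span (\<Union>l. gen_eigenspace l)" for x
  proof -
    obtain B where "finite B" "weyl.span B = weyl.span (range (\<lambda>n. (D ^^ n) x))"
      using fin unfolding locally_finite_def by blast
    from finite_orbit_span_imp_annihilator[OF this]
    obtain f where "f \<noteq> 0" "poly_apply f x = 0" by blast
    then show ?thesis
      by (intro poly_apply_eq_0_imp_span_gen_eigenspaces alg_closed_imp_poly_has_root)
  qed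
  then have span: "weyl.span (\<Union>l. gen_eigenspace l) = UNIV" by blast
  have "\<exists>l x. l \<noteq> 0 \<and> x \<in> gen_eigenspace l \<and> x \<noteq> 0"
  proof (rule ccontr)
    assume "\<not> ?thesis"
    then have "gen_eigenspace l \<subseteq> gen_eigenspace 0" for l
      using weyl.subspace_0[OF subspace_gen_eigenspace, of 0] by (cases "l = 0") auto
    then have "weyl.span (\<Union>l. gen_eigenspace l) \<subseteq> gen_eigenspace 0"
      by (intro weyl.span_minimal subspace_gen_eigenspace) blast
    then have "gen_eigenspace 0 = UNIV" using span by blast
    moreover have "shift 0 = D" by (rule ext) (simp add: shift_def)
    ultimately have nil: "\<exists>n. (D ^^ n) a = 0" for a by (auto simp: gen_eigenspace_def)
    have "\<exists>n\<ge>1. (D ^^ n) a = 0" for a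
    proof -
      obtain n where "(D ^^ n) a = 0" using nil by blast
      then have "(D ^^ Suc n) a = 0" by (simp add: map_zero)
      then show ?thesis by (intro exI[of _ "Suc n"]) auto
    qed
    then show False using not_nil by (simp add: locally_nilpotent_def)
  qed
  then obtain l x where x: "x \<in> gen_eigenspace l" "l \<noteq> 0" "x \<noteq> 0" by blast
  have u0: "u \<in> gen_eigenspace 0"
  proof (rule eigenvector_gen_eigenspace)
    have "D u = 0" by (simp add: u ad_def)
    then show "shift 0 u = 0" by (simp add: shift_def)
  qed
  have aut: "\<rho> \<in> algebra_aut weyl_scale" if "\<rho> \<in> aut_commuting weyl_scale D" for \<rho>
    using that by (simp add: aut_commuting_def)
  \<comment> \<open>\<open>u\<close> is not a scalar since \<open>D \<noteq> 0\<close>, and \<open>\<rho> u\<close> differs from \<open>u\<close> by a scalar.\<close>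
  have deg_u: "1 \<le> weyl_degree (\<rho> u) \<and> weyl_degree (\<rho> u) \<le> weyl_degree u"
    if \<rho>: "\<rho> \<in> aut_commuting weyl_scale D" for \<rho>
  proof -
    obtain c where c: "\<rho> u = u + weyl_scale c 1"
      using aut_commuting_ad_shift \<rho> unfolding u by blast
    have "weyl_degree (weyl_scale c 1) \<le> 0"
      unfolding weyl_degree_le_iff using weyl_below_scale[OF weyl_below_monom[of 0 0 1]] by simp
    then have "weyl_degree (\<rho> u) \<le> weyl_degree u"
      using weyl_degree_add_le[of u "weyl_scale c 1"] c by simp
    moreover have "weyl_degree (\<rho> u) \<noteq> 0"
    proof
      assume "weyl_degree (\<rho> u) = 0"
      from weyl_degree_0_imp_scalar[OF this] obtain d where "\<rho> u = weyl_scale d 1" by blast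
      then have "u = weyl_scale (d - c) 1" using c by (simp add: weyl.scale_left_diff_distrib eq_diff_eq)
      then have "D a = 0" for a by (simp add: u ad_def weyl_scale_1_mult)
      then show False using not_nil by (auto simp: locally_nilpotent_def intro: exI[of _ 1])
    qed
    ultimately show ?thesis by auto
  qed
  have weight0: "\<exists>B. \<forall>\<rho>\<in>aut_commuting weyl_scale D. weyl_degree (\<rho> z) \<le> B"
    if z: "z \<in> gen_eigenspace 0" for z
  proof -
    obtain N c i j where N: "i < N" "j < N" "c (i, j) \<noteq> 0"
      "(\<Sum>(i, j)\<in>{..<N} \<times> {..<N}. weyl_scale (c (i, j)) (z ^ i * u ^ j)) = 0"
      using weight_zero_algebraic_relation[OF z u0 x] by blast
    have "weyl_degree (\<rho> z) \<le> N * weyl_degree u" if \<rho>: "\<rho> \<in> aut_commuting weyl_scale D" for \<rho>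
    proof -
      have "(\<Sum>(i, j)\<in>{..<N} \<times> {..<N}. weyl_scale (c (i, j)) (\<rho> z ^ i * \<rho> u ^ j)) =
        \<rho> (\<Sum>(i, j)\<in>{..<N} \<times> {..<N}. weyl_scale (c (i, j)) (z ^ i * u ^ j))"
        by (simp add: algebra_aut_sum[OF aut[OF \<rho>]] algebra_autD[OF aut[OF \<rho>]] split_beta)
      also have "\<dots> = 0" unfolding N(4) by (rule algebra_autD[OF aut[OF \<rho>]])
      finally have "weyl_degree (\<rho> z) \<le> N * weyl_degree (\<rho> u)"
        using degree_bound_of_algebraic_relation N(1-3) deg_u[OF \<rho>] by blast
      also have "\<dots> \<le> N * weyl_degree u" using deg_u[OF \<rho>] by simp
      finally show ?thesis .
    qed
    then show ?thesis by blast
  qed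
  have homog: "\<exists>B. \<forall>\<rho>\<in>aut_commuting weyl_scale D. weyl_degree (\<rho> y) \<le> B"
    if y: "y \<in> gen_eigenspace m" for m y
  proof (cases "y = 0")
    case True
    then show ?thesis using algebra_autD(6)[OF aut] by (auto simp: weyl_degree_def)
  next
    case False
    obtain b where b: "b \<in> gen_eigenspace (- m)" "b \<noteq> 0"
      using opposite_weight[OF span y False] by blast
    have "y * b \<in> gen_eigenspace 0" using gen_eigenspace_mult[OF y b(1)] by simp
    from weight0[OF this] obtain B where
      B: "\<And>\<rho>. \<rho> \<in> aut_commuting weyl_scale D \<Longrightarrow> weyl_degree (\<rho> (y * b)) \<le> B" by blast
    have "weyl_degree (\<rho> y) \<le> B" if \<rho>: "\<rho> \<in> aut_commuting weyl_scale D" for \<rho>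
      using B[OF \<rho>] b(2) False
      by (simp add: algebra_autD[OF aut[OF \<rho>]] weyl_degree_mult)
    then show ?thesis by blast
  qed
  have "a \<in> weyl.span (\<Union>l. gen_eigenspace l)" by (simp add: span)
  then show ?thesis
  proof (induction rule: weyl.span_induct_alt)
    case base
    show ?case using homog[of 0 0] weyl.subspace_0[OF subspace_gen_eigenspace] by blast
  next
    case (step c y z)
    then obtain m where "y \<in> gen_eigenspace m" by blast
    then have "weyl_scale c y \<in> gen_eigenspace m" by (rule weyl.subspace_scale[OF subspace_gen_eigenspace])
    then obtain B B' where
      B: "\<And>\<rho>. \<rho> \<in> aut_commuting weyl_scale D \<Longrightarrow> weyl_degree (\<rho> (weyl_scale c y)) \<le> B"
        "\<And>\<rho>. \<rho> \<in> aut_commuting weyl_scale D \<Longrightarrow> weyl_degree (\<rho> z) \<le> B'"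
      using homog step(2) by metis
    have "weyl_degree (\<rho> (weyl_scale c y + z)) \<le> max B B'"
      if \<rho>: "\<rho> \<in> aut_commuting weyl_scale D" for \<rho>
    proof -
      have "weyl_degree (\<rho> (weyl_scale c y + z)) \<le>
          max (weyl_degree (\<rho> (weyl_scale c y))) (weyl_degree (\<rho> z))"
        unfolding algebra_autD(1)[OF aut[OF \<rho>]] by (rule weyl_degree_add_le)
      then show ?thesis using B[OF \<rho>] by linarith
    qed
    then show ?case by blast
  qed
qed

theorem theorem8:
  fixes D :: "'k::{alg_closed_field,field_char_0} weyl \<Rightarrow> 'k weyl"
  assumes "derivation weyl_scale D"
    and "locally_finite weyl_scale D"
    and "D \<noteq> (\<lambda>_. 0)"
  shows "locally_nilpotent D \<longleftrightarrow>
    (\<forall>d\<ge>1. \<exists>\<rho>\<in>aut_commuting weyl_scale D. aut_degree \<rho> \<ge> d)"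
proof
  assume "locally_nilpotent D"
  then show "\<forall>d\<ge>1. \<exists>\<rho>\<in>aut_commuting weyl_scale D. aut_degree \<rho> \<ge> d"
    using locally_nilpotent_imp_large_degree[OF assms(1) _ assms(3)] by blast
next
  assume large: "\<forall>d\<ge>1. \<exists>\<rho>\<in>aut_commuting weyl_scale D. aut_degree \<rho> \<ge> d"
  show "locally_nilpotent D"
  proof (rule ccontr)
    assume "\<not> locally_nilpotent D"
    note bounded = not_locally_nilpotent_imp_bounded_degree[OF assms(1,2) this]
    obtain B B' where
      B: "\<And>\<rho>. \<rho> \<in> aut_commuting weyl_scale D \<Longrightarrow> weyl_degree (\<rho> weyl_p) \<le> B"
        "\<And>\<rho>. \<rho> \<in> aut_commuting weyl_scale D \<Longrightarrow> weyl_degree (\<rho> weyl_q) \<le> B'"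
      using bounded[of weyl_p] bounded[of weyl_q] by blast
    obtain \<rho> where "\<rho> \<in> aut_commuting weyl_scale D" "aut_degree \<rho> \<ge> Suc (max B B')"
      using large by (metis One_nat_def Suc_le_mono le0)
    then show False using B[of \<rho>] by (auto simp: aut_degree_def)
  qed
qed

end
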